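(* Let $\alpha>0$ and let $(N,C_1,\dots,C_N)$ be a random vector, where $N\in\{0,1,2,\dots\}\cup\{\infty\}$ and the $C_i$ are real valued random variables such that for all $i$, given $|C_i|>0$, $\log|C_i|\in L$, where $L=\{\lambda j:j\in\mathbb{Z}\}$ for some $\lambda>0$. Assume further that $E\left[\sum_{j=1}^N|C_j|^\alpha\log|C_j|\right]>0$, $E\left[\sum_{j=1}^N|C_j|^\alpha\right]=1$, $E\left[\sum_{j=1}^N|C_j|^\gamma\right]<\infty$ for some $0\le\gamma<\alpha$, and that $R$ is a real valued random variable independent of $(N,C_1,\dots,C_N)$. Consider the two conditions $$(+)\qquad \int_0^\infty\left|P(R>t)-E\left[\sum_{j=1}^N 1(C_jR>t)\right]\right|t^{\alpha-1}\,dt<\infty,$$ $$(-)\qquad \int_0^\infty\left|P(R<-t)-E\left[\sum_{j=1}^N 1(C_jR<-t)\right]\right|t^{\alpha-1}\,dt<\infty,$$ and the quantities $$H_\pm(t)=\frac{\lambda}{E\left[\sum_{j=1}^N|C_j|^\alpha\log|C_j|\right]}\sum_{k=-\infty}^\infty e^{\alpha(t+k\lambda)}\left(P((\pm1)R>e^{t+k\lambda})-E\left[\sum_{j=1}^N1((\pm1)C_jR>e^{t+k\lambda})\right]\right).$$ (a) Suppose $\{C_i\}\ge0$ a.s. If $E[(R^+)^\beta]<\infty$ for any $0<\beta<\alpha$ and $(+)$ holds, then for almost every $t\in\mathbb{R}$ (with respect to Lebesgue measure) $P(R>e^{t+\lambda n})\sim H_+(t)e^{-\alpha(t+\lambda n)}$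 as $n\to\infty$, with $0\le H_+(t)<\infty$. Respectively, if $E[(R^-)^\beta]<\infty$ for any $0<\beta<\alpha$ and $(-)$ holds, then for almost every $t\in\mathbb{R}$ (with respect to Lebesgue measure) $P(R<-e^{t+\lambda n})\sim H_-(t)e^{-\alpha(t+\lambda n)}$ as $n\to\infty$, with $0\le H_-(t)<\infty$. (b) If $P(C_j<0)>0$ for some $j\ge1$, $E[|R|^\beta]<\infty$ for any $0<\beta<\alpha$, and both $(+)$ and $(-)$ hold, then for almost every $t\in\mathbb{R}$ (with respect to Lebesgue measure) $$P(R>e^{t+\lambda n})\sim P(R<-e^{t+\lambda n})\sim H(t)e^{-\alpha(t+\lambda n)},\qquad n\to\infty,$$ where $0\le H(t)=(H_+(t)+H_-(t))/2<\infty$ is given by $$H(t)=\frac{\lambda}{2E\left[\sum_{j=1}^N|C_j|^\alpha\log|C_j|\right]}\sum_{k=-\infty}^\infty e^{\alpha(t+k\lambda)}\left(P(|R|>e^{t+k\lambda})-E\left[\sum_{j=1}^N1(|C_jR|>e^{t+k\lambda})\right]\right).$$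
   Context: Conventions: $x^+=\max(x,0)$, $x^-=\max(-x,0)$; $1(\cdot)$ is the indicator; $0^\alpha\log 0=0$ for $\alpha>0$. Sums $\sum_{j=1}^N$ run over all finite integers $j$ with $1\le j\le N$ (so over all $j\ge1$ if $N=\infty$); the components of the vector may be dependent in an arbitrary way. Statements about $C_j$ such as $P(C_j<0)$ refer to the event on which $C_j$ is present, i.e. $\{N\ge j,\ C_j<0\}$; "$\{C_i\}\ge0$ a.s." means that almost surely $C_i\ge0$ for all $i\le N$. The relation $f(n)\sim H(t)e^{-\alpha(t+\lambda n)}$ means $e^{\alpha(t+\lambda n)}f(n)\to H(t)$ as $n\to\infty$ (also when $H(t)=0$).
   Formalization: λ is taken to be the span (no larger λ' has all log|C_i| in λ'Z), and in (b) it is also assumed that not all nonzero C_j lie in {(-e^λ)^k : k in Z}; without either condition the normalised tails can oscillate and the claim is false. *)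

theory Defs
  imports "HOL-Probability.Probability"
begin

text \<open>The components present in the vector are those with index \<open>1 \<le> j \<le> N\<close>, where \<open>N\<close> may be
  infinite.\<close>

definition present :: "enat \<Rightarrow> nat set" where
  "present n = {j. 1 \<le> j \<and> enat j \<le> n}"

text \<open>The random vector \<open>(N, C\<^sub>1, \<dots>, C\<^sub>N)\<close> as a single random element. Its length is not fixed, so
  it is padded with zeros beyond \<open>N\<close>; nothing is lost, as \<open>N\<close> itself is recorded. In particular
  \<open>C j\<close> need not be measurable, or independent of anything, off the event \<open>j \<le> N\<close>.\<close>

definition weight_vector ::
    "('a \<Rightarrow> enat) \<Rightarrow> (nat \<Rightarrow> 'a \<Rightarrow> real) \<Rightarrow> 'a \<Rightarrow> enat \<times> (nat \<Rightarrow> real)" where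
  "weight_vector N C \<omega> = (N \<omega>, \<lambda>j\<in>{1..}. if j \<in> present (N \<omega>) then C j \<omega> else 0)"

definition vector_algebra :: "(enat \<times> (nat \<Rightarrow> real)) measure" where
  "vector_algebra = count_space UNIV \<Otimes>\<^sub>M (\<Pi>\<^sub>M j\<in>{1..}. borel)"

text \<open>\<open>indep_var\<close> requires both variables to take values in the same type, hence the formulation
  with the generated sigma-algebras.\<close>

definition indep_of_weights ::
    "'a measure \<Rightarrow> ('a \<Rightarrow> enat) \<Rightarrow> (nat \<Rightarrow> 'a \<Rightarrow> real) \<Rightarrow> ('a \<Rightarrow> real) \<Rightarrow> bool" where
  "indep_of_weights M N C R \<longleftrightarrow>
     prob_space.indep_set M
       (sets (vimage_algebra (space M) R borel))
       (sets (vimage_algebra (space M) (weight_vector N C) vector_algebra))"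

text \<open>Expectation with values in the extended reals, \<open>E[X\<^sup>+] - E[X\<^sup>-]\<close>; the value \<open>\<infinity>\<close> is
  legitimate when only \<open>E[X\<^sup>-]\<close> is finite.\<close>

definition ext_expectation :: "'a measure \<Rightarrow> ('a \<Rightarrow> real) \<Rightarrow> ereal" where
  "ext_expectation M X =
     enn2ereal (\<integral>\<^sup>+\<omega>. ennreal (X \<omega>) \<partial>M) - enn2ereal (\<integral>\<^sup>+\<omega>. ennreal (- X \<omega>) \<partial>M)"

text \<open>Since \<open>0 powr b = 0\<close> for every \<open>b\<close>, vanishing weights contribute \<open>0\<close> also when \<open>b = 0\<close>.\<close>

definition weight_moment ::
    "'a measure \<Rightarrow> ('a \<Rightarrow> enat) \<Rightarrow> (nat \<Rightarrow> 'a \<Rightarrow> real) \<Rightarrow> real \<Rightarrow> ennreal" where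
  "weight_moment M N C b =
     (\<integral>\<^sup>+\<omega>. (\<Sum>\<^sub>\<infinity>j\<in>present (N \<omega>). ennreal (\<bar>C j \<omega>\<bar> powr b)) \<partial>M)"

text \<open>A finite \<open>a\<close>-moment and a finite \<open>c\<close>-moment for some \<open>c < a\<close> make the series below
  absolutely convergent almost surely, with an integrable negative part; the positive part need
  not be integrable.\<close>

definition weight_drift ::
    "'a measure \<Rightarrow> ('a \<Rightarrow> enat) \<Rightarrow> (nat \<Rightarrow> 'a \<Rightarrow> real) \<Rightarrow> real \<Rightarrow> ereal" where
  "weight_drift M N C a =
     ext_expectation M (\<lambda>\<omega>. \<Sum>\<^sub>\<infinity>j\<in>present (N \<omega>). \<bar>C j \<omega>\<bar> powr a * ln \<bar>C j \<omega>\<bar>)"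

definition lattice :: "real \<Rightarrow> real set" where
  "lattice l = {l * of_int k | k :: int. True}"

definition nonzero_weights_in ::
    "'a measure \<Rightarrow> ('a \<Rightarrow> enat) \<Rightarrow> (nat \<Rightarrow> 'a \<Rightarrow> real) \<Rightarrow> real set \<Rightarrow> bool" where
  "nonzero_weights_in M N C S \<longleftrightarrow>
     (\<forall>j. AE \<omega> in M. j \<in> present (N \<omega>) \<and> \<bar>C j \<omega>\<bar> > 0 \<longrightarrow> C j \<omega> \<in> S)"

definition log_weights_in ::
    "'a measure \<Rightarrow> ('a \<Rightarrow> enat) \<Rightarrow> (nat \<Rightarrow> 'a \<Rightarrow> real) \<Rightarrow> real \<Rightarrow> bool" where
  "log_weights_in M N C l \<longleftrightarrow> nonzero_weights_in M N C {x. ln \<bar>x\<bar> \<in> lattice l}"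

text \<open>The law of the logarithms of the weights is lattice with span \<open>l\<close>: it is carried by
  \<open>l \<int>\<close> and by no coarser lattice. With a mere sub-multiple of the span in place of \<open>l\<close> the
  normalised tail along \<open>t + l n\<close> may oscillate.\<close>

definition lattice_span ::
    "'a measure \<Rightarrow> ('a \<Rightarrow> enat) \<Rightarrow> (nat \<Rightarrow> 'a \<Rightarrow> real) \<Rightarrow> real \<Rightarrow> bool" where
  "lattice_span M N C l \<longleftrightarrow> l > 0 \<and> log_weights_in M N C l \<and> (\<forall>l'>l. \<not> log_weights_in M N C l')"

text \<open>The sign of every nonzero weight is the parity of its logarithm divided by \<open>l\<close>. The group
  generated by the weights is then cyclic, instead of the two-sided group of all \<open>x\<close> with
  \<open>ln \<bar>x\<bar> \<in> lattice l\<close>, and the signed tails are periodic along \<open>t + l n\<close> with period two.\<close>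

definition sign_locked ::
    "'a measure \<Rightarrow> ('a \<Rightarrow> enat) \<Rightarrow> (nat \<Rightarrow> 'a \<Rightarrow> real) \<Rightarrow> real \<Rightarrow> bool" where
  "sign_locked M N C l \<longleftrightarrow> nonzero_weights_in M N C {(- exp l) powi k | k :: int. True}"

definition weights_nonneg :: "'a measure \<Rightarrow> ('a \<Rightarrow> enat) \<Rightarrow> (nat \<Rightarrow> 'a \<Rightarrow> real) \<Rightarrow> bool" where
  "weights_nonneg M N C \<longleftrightarrow> (AE \<omega> in M. \<forall>j\<in>present (N \<omega>). 0 \<le> C j \<omega>)"

definition lower_moments_finite :: "'a measure \<Rightarrow> real \<Rightarrow> ('a \<Rightarrow> real) \<Rightarrow> bool" where
  "lower_moments_finite M a X \<longleftrightarrow>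
     (\<forall>b. 0 < b \<and> b < a \<longrightarrow> (\<integral>\<^sup>+\<omega>. ennreal (X \<omega> powr b) \<partial>M) < \<infinity>)"

definition right_tail :: "real \<Rightarrow> real set" where "right_tail u = {x. x > u}"
definition left_tail :: "real \<Rightarrow> real set" where "left_tail u = {x. x < - u}"
definition abs_tail :: "real \<Rightarrow> real set" where "abs_tail u = {x. \<bar>x\<bar> > u}"

text \<open>\<open>P(R \<in> A) - E[\<Sum>j\<le>N. 1(C\<^sub>j R \<in> A)]\<close>, where the expectation may a priori be infinite.\<close>

definition tail_gap ::
    "'a measure \<Rightarrow> ('a \<Rightarrow> enat) \<Rightarrow> (nat \<Rightarrow> 'a \<Rightarrow> real) \<Rightarrow> ('a \<Rightarrow> real) \<Rightarrow> real set \<Rightarrow> ereal" where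
  "tail_gap M N C R A =
     ereal (measure M {\<omega> \<in> space M. R \<omega> \<in> A})
     - enn2ereal (\<integral>\<^sup>+\<omega>. (\<Sum>\<^sub>\<infinity>j\<in>present (N \<omega>). (indicator A (C j \<omega> * R \<omega>) :: ennreal)) \<partial>M)"

definition gap_integrable ::
    "'a measure \<Rightarrow> ('a \<Rightarrow> enat) \<Rightarrow> (nat \<Rightarrow> 'a \<Rightarrow> real) \<Rightarrow> ('a \<Rightarrow> real) \<Rightarrow> real
      \<Rightarrow> (real \<Rightarrow> real set) \<Rightarrow> bool" where
  "gap_integrable M N C R a T \<longleftrightarrow>
     (\<integral>\<^sup>+t\<in>{0<..}. e2ennreal \<bar>tail_gap M N C R (T t)\<bar> * ennreal (t powr (a - 1)) \<partial>lborel) < \<infinity>"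

definition lattice_term ::
    "'a measure \<Rightarrow> ('a \<Rightarrow> enat) \<Rightarrow> (nat \<Rightarrow> 'a \<Rightarrow> real) \<Rightarrow> ('a \<Rightarrow> real) \<Rightarrow> real \<Rightarrow> real
      \<Rightarrow> (real \<Rightarrow> real set) \<Rightarrow> real \<Rightarrow> int \<Rightarrow> real" where
  "lattice_term M N C R a l T t k =
     exp (a * (t + of_int k * l)) * real_of_ereal (tail_gap M N C R (T (exp (t + of_int k * l))))"

text \<open>With \<open>m\<close> the drift this is \<open>H\<^sub>+\<close> or \<open>H\<^sub>-\<close>, with \<open>m\<close> twice the drift and the tails of
  \<open>\<bar>R\<bar>\<close> it is \<open>H\<close>. The factor \<open>l / m\<close> is \<open>0\<close> if the drift is infinite.\<close>

definition lattice_H ::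
    "'a measure \<Rightarrow> ('a \<Rightarrow> enat) \<Rightarrow> (nat \<Rightarrow> 'a \<Rightarrow> real) \<Rightarrow> ('a \<Rightarrow> real) \<Rightarrow> real \<Rightarrow> real \<Rightarrow> ereal
      \<Rightarrow> (real \<Rightarrow> real set) \<Rightarrow> real \<Rightarrow> real" where
  "lattice_H M N C R a l m T t =
     real_of_ereal (ereal l / m) * (\<Sum>\<^sub>\<infinity>k. lattice_term M N C R a l T t k)"

text \<open>\<open>f n \<sim> h e\<^bsup>-a(t + l n)\<^esup>\<close>, in the sense that also makes sense for \<open>h = 0\<close>.\<close>

definition exp_asymp :: "real \<Rightarrow> real \<Rightarrow> real \<Rightarrow> (nat \<Rightarrow> real) \<Rightarrow> real \<Rightarrow> bool" where
  "exp_asymp a l t f h \<longleftrightarrow> (\<lambda>n. exp (a * (t + l * real n)) * f n) \<longlonglongrightarrow> h"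

end

theory Submission
  imports Defs "HOL-Real_Asymp.Real_Asymp"
begin

text \<open>
  Weighting the pair (outcome, index \<open>j\<close>) by \<open>\<bar>C\<^sub>j\<bar>\<^sup>\<alpha>\<close> gives a measure of total mass
  \<open>E[\<Sum>\<bar>C\<^sub>j\<bar>\<^sup>\<alpha>] = 1\<close>. Under this \<open>tilted\<close> probability the chosen weight is \<open>e exp (l X)\<close> with a
  sign \<open>e\<close> and an integer \<open>X\<close>, and the drift is \<open>\<mu> = l E[X]\<close>. Put
  \<open>\<rho> t s n = exp (\<alpha> (t + n l)) P(s R > exp (t + n l))\<close>. Independence of \<open>R\<close> turns the definition
  of the tail gap into a renewal equation \<open>\<rho> t s n = g s n + E[\<rho> t (s e) (n - X)]\<close>, where \<open>g\<close>
  is the summand of \<open>H\<^sub>\<plusminus>\<close> (\<open>lattice_term_renewal\<close>). The integrability conditions are integrals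
  over \<open>t\<close> of \<open>\<Sum>\<^sub>n \<bar>g s n\<bar>\<close>, which is therefore finite for almost every \<open>t\<close>
  (\<open>AE_lattice_summable\<close>).

  The walk with steps \<open>X\<close> drifts upwards and has a negative exponential moment, so
  \<open>E[exp (- \<theta> X)] < 1\<close> for small \<open>\<theta> > 0\<close>, while the moments of \<open>R\<close> give \<open>\<rho> t s n \<le> K exp (\<theta> n)\<close>.
  As no coarser lattice than the one of span \<open>l\<close> carries the logarithms, the steps generate \<open>\<int>\<close>.
  A nonnegative solution \<open>r\<close> of \<open>r n = g n + E[r (n - X)]\<close> within that growth class then converges to
  \<open>(\<Sum> g) / E[X]\<close>, and to \<open>0\<close> if \<open>E[X] = \<infinity>\<close>. Instead of the asymptotics of the Green function,
  the argument uses three properties of \<open>r\<close> itself.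

  \<^item> It is bounded, because an explicit superharmonic function dominates it (\<open>subsolution_bounded\<close>).

  \<^item> It varies slowly: a bounded function that is asymptotically harmonic at \<open>+\<infinity>\<close> is
    asymptotically periodic under every step that the walk can make, hence under the group that
    the steps generate (\<open>asymptotic_liouville\<close>, a form of the Choquet-Deny theorem).

  \<^item> Its sums \<open>S n = \<Sum>i\<ge>0. r (n - i)\<close> satisfy \<open>E[S n - S (n - X)] = \<Sum>i\<ge>0. g (n - i)\<close>. The right
    side tends to \<open>\<Sum> g\<close>, and slow variation makes the left side asymptotic to \<open>r n E[X]\<close>.

  If all weights are nonnegative, this applies to each tail separately. If negative weights occur,
  it applies to the sum of the two tails, whereas their difference \<open>d\<close> satisfies
  \<open>d n = \<dots> + E[e d (n - X)]\<close> with a summable forcing term. Unless the sign \<open>e\<close> is almost surely a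
  character of \<open>X\<close>, that is \<open>e = 1\<close> or \<open>e = (-1)\<^sup>X\<close>, the same Liouville property forces \<open>d n\<close> to
  tend to \<open>0\<close> (\<open>signed_liouville\<close>). The two characters are the nonnegative and the sign-locked
  case, so both tails have half the limit of their sum.
\<close>


section \<open>Asymptotically harmonic functions on the integers\<close>

text \<open>If \<open>D\<close> is asymptotically the average of \<open>e D(n - X)\<close> and its values along \<open>k\<close> approach the
  extreme modulus \<open>\<bar>\<sigma>\<bar>\<close>, then almost all the values averaged must be extreme as well: the
  nonnegative part of \<open>\<sigma>\<^sup>2 - \<sigma> e D(k i - X)\<close> cannot stay away from \<open>0\<close> when its mean tends to \<open>0\<close> and
  its negative part vanishes in the limit. An atom of \<open>(X, e)\<close> sees this pointwise.\<close>

lemma (in prob_space) extremal_value_propagates: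
  fixes D :: "int \<Rightarrow> real" and X :: "'a \<Rightarrow> int" and e :: "'a \<Rightarrow> real" and k :: "nat \<Rightarrow> int"
  assumes X [measurable]: "X \<in> M \<rightarrow>\<^sub>M count_space UNIV" and e [measurable]: "e \<in> borel_measurable M"
    and e1: "\<And>x. \<bar>e x\<bar> = 1"
    and bdd: "\<And>n. \<bar>D n\<bar> \<le> B"
    and harm: "((\<lambda>n. D n - expectation (\<lambda>x. e x * D (n - X x))) \<longlongrightarrow> 0) at_top"
    and top: "\<And>\<delta>. 0 < \<delta> \<Longrightarrow> \<forall>\<^sub>F n in at_top. \<bar>D n\<bar> \<le> \<bar>\<sigma>\<bar> + \<delta>"
    and k: "filterlim k at_top sequentially" and lim: "(\<lambda>i. D (k i)) \<longlonglongrightarrow> \<sigma>"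
    and pos: "prob {x \<in> space M. X x = y \<and> e x = s} > 0"
    and \<sigma>: "\<sigma> \<noteq> 0"
  shows "(\<lambda>i. D (k i - y)) \<longlonglongrightarrow> s * \<sigma>"
proof -
  define A where "A = {x \<in> space M. X x = y \<and> e x = s}"
  have A [measurable]: "A \<in> sets M" unfolding A_def by measurable
  have s1: "\<bar>s\<bar> = 1"
  proof -
    have "A \<noteq> {}" using pos by (auto simp: A_def[symmetric])
    then show ?thesis using e1 by (auto simp: A_def)
  qed
  define W where "W i x = \<sigma>\<^sup>2 - \<sigma> * (e x * D (k i - X x))" for i x
  have [measurable]: "(\<lambda>x. D (k i - X x)) \<in> borel_measurable M" for i
    by (rule measurable_compose[OF X]) auto
  have Wm [measurable]: "W i \<in> borel_measurable M" for i unfolding W_def by measurable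
  have eD: "\<bar>e x * D n\<bar> \<le> B" for x n using bdd[of n] e1[of x] by (simp add: abs_mult)
  have Wb: "\<bar>W i x\<bar> \<le> \<sigma>\<^sup>2 + \<bar>\<sigma>\<bar> * B" for i x
  proof -
    have "\<bar>\<sigma> * (e x * D (k i - X x))\<bar> \<le> \<bar>\<sigma>\<bar> * B"
      unfolding abs_mult[of \<sigma>] by (intro mult_left_mono eD) auto
    moreover have "0 \<le> \<sigma>\<^sup>2" by simp
    ultimately show ?thesis unfolding W_def by linarith
  qed
  have Wint: "integrable M (W i)" for i
    by (rule integrable_const_bound[of _ "\<sigma>\<^sup>2 + \<bar>\<sigma>\<bar> * B"]) (use Wb in auto)
  have eDint: "integrable M (\<lambda>x. e x * D (k i - X x))" for i
    by (rule integrable_const_bound[of _ B]) (use eD in auto)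
  have EW: "(\<lambda>i. expectation (W i)) \<longlonglongrightarrow> 0"
  proof -
    have "(\<lambda>i. D (k i) - expectation (\<lambda>x. e x * D (k i - X x))) \<longlonglongrightarrow> 0"
      using filterlim_compose[OF harm k] .
    from tendsto_diff[OF lim this]
    have "(\<lambda>i. expectation (\<lambda>x. e x * D (k i - X x))) \<longlonglongrightarrow> \<sigma>" by simp
    then have "(\<lambda>i. \<sigma>\<^sup>2 - \<sigma> * expectation (\<lambda>x. e x * D (k i - X x))) \<longlonglongrightarrow> \<sigma>\<^sup>2 - \<sigma> * \<sigma>"
      by (intro tendsto_intros)
    moreover have "expectation (W i) = \<sigma>\<^sup>2 - \<sigma> * expectation (\<lambda>x. e x * D (k i - X x))" for i
      unfolding W_def using eDint by (simp add: prob_space)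
    ultimately show ?thesis by (simp add: power2_eq_square)
  qed
  have neg: "(\<lambda>i. expectation (\<lambda>x. max 0 (- W i x))) \<longlonglongrightarrow> expectation (\<lambda>x. 0)"
  proof (rule integral_dominated_convergence[where w = "\<lambda>_. \<sigma>\<^sup>2 + \<bar>\<sigma>\<bar> * B"])
    show "AE x in M. (\<lambda>i. max 0 (- W i x)) \<longlonglongrightarrow> 0"
    proof (intro AE_I2 tendstoI)
      fix x and \<epsilon> :: real assume "0 < \<epsilon>"
      define \<delta> where "\<delta> = \<epsilon> / (2 * \<bar>\<sigma>\<bar>)"
      have \<delta>: "0 < \<delta>" "\<bar>\<sigma>\<bar> * \<delta> < \<epsilon>" using \<open>0 < \<epsilon>\<close> \<sigma> by (auto simp: \<delta>_def)
      have "filterlim (\<lambda>i. k i - X x) at_top sequentially"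
        unfolding filterlim_at_top
      proof
        fix Z show "\<forall>\<^sub>F i in sequentially. Z \<le> k i - X x"
          using k[unfolded filterlim_at_top, rule_format, of "Z + X x"] by eventually_elim simp
      qed
      from top[OF \<delta>(1)] this have "\<forall>\<^sub>F i in sequentially. \<bar>D (k i - X x)\<bar> \<le> \<bar>\<sigma>\<bar> + \<delta>"
        by (rule eventually_compose_filterlim)
      then show "\<forall>\<^sub>F i in sequentially. dist (max 0 (- W i x)) 0 < \<epsilon>"
      proof (rule eventually_mono)
        fix i assume *: "\<bar>D (k i - X x)\<bar> \<le> \<bar>\<sigma>\<bar> + \<delta>"
        have "\<sigma> * (e x * D (k i - X x)) \<le> \<bar>\<sigma> * (e x * D (k i - X x))\<bar>" by simp
        also have "\<dots> = \<bar>\<sigma>\<bar> * \<bar>D (k i - X x)\<bar>" using e1[of x] by (simp add: abs_mult)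
        also have "\<dots> \<le> \<bar>\<sigma>\<bar> * (\<bar>\<sigma>\<bar> + \<delta>)" using * by (intro mult_left_mono) auto
        also have "\<dots> = \<sigma>\<^sup>2 + \<bar>\<sigma>\<bar> * \<delta>" by (simp add: algebra_simps power2_eq_square)
        finally show "dist (max 0 (- W i x)) 0 < \<epsilon>"
          using \<delta>(2) \<open>0 < \<epsilon>\<close> by (auto simp: W_def)
      qed
    qed
    show "AE x in M. norm (max 0 (- W i x)) \<le> \<sigma>\<^sup>2 + \<bar>\<sigma>\<bar> * B" for i
    proof (rule AE_I2)
      fix x show "norm (max 0 (- W i x)) \<le> \<sigma>\<^sup>2 + \<bar>\<sigma>\<bar> * B"
        using Wb[of i x] abs_ge_zero[of "W i x"] by (auto simp: max_def abs_if split: if_splits)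
    qed
  qed auto
  have "(\<lambda>i. expectation (W i) + 2 * expectation (\<lambda>x. max 0 (- W i x))) \<longlonglongrightarrow> 0 + 2 * 0"
    using neg by (intro tendsto_intros EW) simp
  moreover have "expectation (W i) + 2 * expectation (\<lambda>x. max 0 (- W i x)) = expectation (\<lambda>x. \<bar>W i x\<bar>)" for i
  proof -
    have "expectation (W i) + 2 * expectation (\<lambda>x. max 0 (- W i x))
        = expectation (\<lambda>x. W i x + 2 * max 0 (- W i x))"
      using Wint by (subst Bochner_Integration.integral_add) auto
    also have "\<dots> = expectation (\<lambda>x. \<bar>W i x\<bar>)"
      by (intro Bochner_Integration.integral_cong) auto
    finally show ?thesis .
  qed
  \<comment> \<open>\<open>\<bar>x\<bar> = x + 2 max 0 (- x)\<close> upgrades convergence of means to convergence in \<open>L\<^sup>1\<close>.\<close>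
  ultimately have absW: "(\<lambda>i. expectation (\<lambda>x. \<bar>W i x\<bar>)) \<longlonglongrightarrow> 0" by simp
  have ge: "prob A * \<bar>\<sigma>\<^sup>2 - \<sigma> * (s * D (k i - y))\<bar> \<le> expectation (\<lambda>x. \<bar>W i x\<bar>)" for i
  proof -
    have "prob A * \<bar>\<sigma>\<^sup>2 - \<sigma> * (s * D (k i - y))\<bar>
       = expectation (\<lambda>x. \<bar>\<sigma>\<^sup>2 - \<sigma> * (s * D (k i - y))\<bar> * indicator A x)"
      by simp
    also have "\<dots> \<le> expectation (\<lambda>x. \<bar>W i x\<bar>)"
    proof (rule integral_mono)
      show "integrable M (\<lambda>x. \<bar>\<sigma>\<^sup>2 - \<sigma> * (s * D (k i - y))\<bar> * indicator A x)"
        by (intro integrable_mult_right integrable_real_indicator) (simp_all add: emeasure_eq_measure)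
      show "integrable M (\<lambda>x. \<bar>W i x\<bar>)" using Wint by simp
    qed (auto simp: indicator_def A_def W_def)
    finally show ?thesis .
  qed
  have "(\<lambda>i. prob A * \<bar>\<sigma>\<^sup>2 - \<sigma> * (s * D (k i - y))\<bar>) \<longlonglongrightarrow> 0"
    by (rule tendsto_sandwich[OF _ _ tendsto_const absW]) (use ge in auto)
  from tendsto_mult_left[OF this, of "1 / prob A"]
  have "(\<lambda>i. \<bar>\<sigma>\<^sup>2 - \<sigma> * (s * D (k i - y))\<bar>) \<longlonglongrightarrow> 0"
    using pos by (simp add: A_def[symmetric])
  then have "(\<lambda>i. \<sigma>\<^sup>2 - \<sigma> * (s * D (k i - y))) \<longlonglongrightarrow> 0"
    by (simp add: tendsto_rabs_zero_iff)
  from tendsto_diff[OF tendsto_const[of "\<sigma>\<^sup>2"] this]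
  have "(\<lambda>i. \<sigma> * (s * D (k i - y))) \<longlonglongrightarrow> \<sigma>\<^sup>2" by simp
  from tendsto_mult_left[OF this, of "s / \<sigma>"]
  have "(\<lambda>i. (s * s) * D (k i - y)) \<longlonglongrightarrow> s * \<sigma>"
    using \<sigma> by (simp add: power2_eq_square mult_ac)
  moreover have "s * s = 1" using s1 by (metis abs_mult_self_eq mult_1_right)
  ultimately show ?thesis by simp
qed

text \<open>A sequence realising the limit superior of \<open>\<bar>D\<bar>\<close>, refined so that \<open>D\<close> itself converges along it.\<close>

lemma limsup_sequence_int:
  fixes D :: "int \<Rightarrow> real"
  assumes bdd: "\<And>n. \<bar>D n\<bar> \<le> B" and nz: "\<not> (D \<longlongrightarrow> 0) at_top"
  obtains k :: "nat \<Rightarrow> int" and \<sigma> where "\<sigma> \<noteq> 0" "filterlim k at_top sequentially"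
    "(\<lambda>i. D (k i)) \<longlonglongrightarrow> \<sigma>" "\<And>\<delta>. 0 < \<delta> \<Longrightarrow> \<forall>\<^sub>F n in at_top. \<bar>D n\<bar> \<le> \<bar>\<sigma>\<bar> + \<delta>"
proof -
  define S where "S = {b. 0 \<le> b \<and> (\<forall>\<^sub>F n in at_top. \<bar>D n\<bar> \<le> b)}"
  have B0: "0 \<le> B" using bdd[of 0] by linarith
  have BS: "B \<in> S" using bdd B0 by (auto simp: S_def)
  have Sb: "bdd_below S" by (auto simp: S_def bdd_below_def)
  define s where "s = Inf S"
  have s0: "0 \<le> s" unfolding s_def using BS by (intro cInf_greatest) (auto simp: S_def)
  have up: "\<forall>\<^sub>F n in at_top. \<bar>D n\<bar> \<le> s + \<delta>" if "0 < \<delta>" for \<delta>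
  proof -
    have "Inf S < s + \<delta>" "S \<noteq> {}" using that BS by (auto simp: s_def)
    then obtain b where "b \<in> S" "b < s + \<delta>" using cInf_lessD by blast
    then have "\<forall>\<^sub>F n in at_top. \<bar>D n\<bar> \<le> b" "b \<le> s + \<delta>" by (auto simp: S_def)
    then show ?thesis by (auto elim: eventually_mono)
  qed
  have spos: "0 < s"
  proof (rule ccontr)
    assume "\<not> 0 < s"
    with s0 have "s = 0" by simp
    have "(D \<longlongrightarrow> 0) at_top"
    proof (rule tendstoI)
      fix \<epsilon> :: real assume "0 < \<epsilon>"
      then have "\<forall>\<^sub>F n in at_top. \<bar>D n\<bar> \<le> s + \<epsilon> / 2" by (intro up) simp
      then show "\<forall>\<^sub>F n in at_top. dist (D n) 0 < \<epsilon>"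
        by eventually_elim (use \<open>s = 0\<close> \<open>0 < \<epsilon>\<close> in auto)
    qed
    with nz show False by simp
  qed
  have low: "\<exists>n \<ge> Z. \<bar>D n\<bar> > s - \<delta>" if "0 < \<delta>" for \<delta> and Z :: int
  proof (rule ccontr)
    assume "\<not> ?thesis"
    then have "\<forall>n \<ge> Z. \<bar>D n\<bar> \<le> s - \<delta>" by force
    then have "\<forall>\<^sub>F n in at_top. \<bar>D n\<bar> \<le> max 0 (s - \<delta>)"
      unfolding eventually_at_top_linorder by (intro exI[of _ Z]) auto
    then have "max 0 (s - \<delta>) \<in> S" by (simp add: S_def)
    then have "s \<le> max 0 (s - \<delta>)" unfolding s_def by (intro cInf_lower Sb)
    with spos that show False by simp
  qed
  have "\<forall>i::nat. \<exists>n. n \<ge> int i \<and> \<bar>D n\<bar> > s - 1 / Suc i"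
    using low by (auto simp: Bex_def)
  then obtain n where n: "\<And>i::nat. n i \<ge> int i" "\<And>i. \<bar>D (n i)\<bar> > s - 1 / Suc i" by metis
  have ntop: "filterlim n at_top sequentially"
    by (rule filterlim_at_top_mono[OF filterlim_int_sequentially]) (use n in auto)
  have Dn: "(\<lambda>i. \<bar>D (n i)\<bar>) \<longlonglongrightarrow> s"
  proof (rule order_tendstoI)
    fix a assume "a < s"
    have "(\<lambda>i. s - 1 / Suc i) \<longlonglongrightarrow> s - 0"
      by (intro tendsto_intros LIMSEQ_Suc[OF lim_1_over_n])
    then have "\<forall>\<^sub>F i in sequentially. a < s - 1 / Suc i"
      using \<open>a < s\<close> by (auto dest!: order_tendstoD(1))
    then show "\<forall>\<^sub>F i in sequentially. a < \<bar>D (n i)\<bar>"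
      by eventually_elim (use n(2) in \<open>meson less_trans\<close>)
  next
    fix a assume "s < a"
    then have "\<forall>\<^sub>F m in at_top. \<bar>D m\<bar> \<le> s + (a - s) / 2" by (intro up) simp
    then have "\<forall>\<^sub>F i in sequentially. \<bar>D (n i)\<bar> \<le> s + (a - s) / 2"
      using ntop by (rule eventually_compose_filterlim)
    then show "\<forall>\<^sub>F i in sequentially. \<bar>D (n i)\<bar> < a"
      by eventually_elim (use \<open>s < a\<close> in \<open>auto simp: field_simps\<close>)
  qed
  have "bounded (range (\<lambda>i. D (n i)))" using bdd by (auto simp: bounded_iff)
  from bounded_imp_convergent_subsequence[OF this] obtain \<sigma> f where
    f: "strict_mono (f :: nat \<Rightarrow> nat)" "((\<lambda>i. D (n i)) \<circ> f) \<longlonglongrightarrow> \<sigma>" by auto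
  have "(\<lambda>i. \<bar>D (n (f i))\<bar>) \<longlonglongrightarrow> \<bar>\<sigma>\<bar>" using f(2) by (intro tendsto_rabs) (simp add: o_def)
  moreover have "(\<lambda>i. \<bar>D (n (f i))\<bar>) \<longlonglongrightarrow> s"
    using LIMSEQ_subseq_LIMSEQ[OF Dn f(1)] by (simp add: o_def)
  ultimately have \<sigma>: "\<bar>\<sigma>\<bar> = s" using LIMSEQ_unique by blast
  show thesis
  proof (rule that[of \<sigma> "n \<circ> f"])
    show "\<sigma> \<noteq> 0" using \<sigma> spos by auto
    show "filterlim (n \<circ> f) at_top sequentially"
      unfolding o_def using filterlim_compose[OF ntop filterlim_subseq[OF f(1)]] .
    show "(\<lambda>i. D ((n \<circ> f) i)) \<longlonglongrightarrow> \<sigma>" using f(2) by (simp add: o_def)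
  qed (use up \<sigma> in auto)
qed

lemma filterlim_minus_const_int_at_top: "filterlim (\<lambda>n::int. n - c) at_top at_top"
  unfolding filterlim_at_top
proof
  fix Z :: int show "\<forall>\<^sub>F n in at_top. Z \<le> n - c"
    using eventually_ge_at_top[of "Z + c"] by eventually_elim simp
qed

text \<open>Otherwise the increments \<open>D n = h n - s h(n - y)\<close> come close to some \<open>\<sigma> \<noteq> 0\<close> of extreme modulus,
  and by propagation so do \<open>J\<close> consecutive increments up to the sign \<open>s\<^sup>j\<close>. They add up to
  about \<open>J \<sigma>\<close>, which exceeds the oscillation of the bounded function \<open>h\<close> once \<open>J\<close> is large.\<close>

lemma (in prob_space) asymptotic_liouville:
  fixes h :: "int \<Rightarrow> real" and X :: "'a \<Rightarrow> int" and e :: "'a \<Rightarrow> real"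
  assumes X [measurable]: "X \<in> M \<rightarrow>\<^sub>M count_space UNIV" and e [measurable]: "e \<in> borel_measurable M"
    and e1: "\<And>x. \<bar>e x\<bar> = 1"
    and bdd: "\<And>n. \<bar>h n\<bar> \<le> B"
    and harm: "((\<lambda>n. h n - expectation (\<lambda>x. e x * h (n - X x))) \<longlongrightarrow> 0) at_top"
    and pos: "prob {x \<in> space M. X x = y \<and> e x = s} > 0"
  shows "((\<lambda>n. h n - s * h (n - y)) \<longlongrightarrow> 0) at_top"
proof (rule ccontr)
  assume nz: "\<not> ((\<lambda>n. h n - s * h (n - y)) \<longlongrightarrow> 0) at_top"
  define D where "D n = h n - s * h (n - y)" for n
  have s1: "\<bar>s\<bar> = 1"
  proof -
    have "{x \<in> space M. X x = y \<and> e x = s} \<noteq> {}" using pos by (auto simp del: Collect_empty_eq)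
    then show ?thesis using e1 by auto
  qed
  have Db: "\<bar>D n\<bar> \<le> 2 * B" for n
  proof -
    have "\<bar>s * h (n - y)\<bar> \<le> B" using bdd[of "n - y"] s1 by (simp add: abs_mult)
    with bdd[of n] show ?thesis unfolding D_def by linarith
  qed
  have [measurable]: "(\<lambda>x. h (n - X x)) \<in> borel_measurable M" for n
    by (rule measurable_compose[OF X]) auto
  have int: "integrable M (\<lambda>x. e x * h (n - X x))" for n
    by (rule integrable_const_bound[of _ B]) (use bdd e1 in \<open>auto simp: abs_mult\<close>)
  have Dh: "((\<lambda>n. D n - expectation (\<lambda>x. e x * D (n - X x))) \<longlongrightarrow> 0) at_top"
  proof -
    have "expectation (\<lambda>x. e x * D (n - X x)) =
        expectation (\<lambda>x. e x * h (n - X x)) - s * expectation (\<lambda>x. e x * h (n - y - X x))" for n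
    proof -
      have "expectation (\<lambda>x. e x * D (n - X x)) =
          expectation (\<lambda>x. e x * h (n - X x) - s * (e x * h (n - y - X x)))"
        by (intro Bochner_Integration.integral_cong) (auto simp: D_def algebra_simps)
      then show ?thesis using int[of n] int[of "n - y"] by simp
    qed
    then have eq: "D n - expectation (\<lambda>x. e x * D (n - X x)) =
       (h n - expectation (\<lambda>x. e x * h (n - X x)))
       - s * (h (n - y) - expectation (\<lambda>x. e x * h (n - y - X x)))" for n
      by (simp add: D_def algebra_simps)
    have "((\<lambda>n. (h n - expectation (\<lambda>x. e x * h (n - X x)))
       - s * (h (n - y) - expectation (\<lambda>x. e x * h (n - y - X x)))) \<longlongrightarrow> 0 - s * 0) at_top"
      by (intro tendsto_intros harm filterlim_compose[OF harm filterlim_minus_const_int_at_top])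
    then show ?thesis by (simp add: eq)
  qed
  obtain k \<sigma> where \<sigma>: "\<sigma> \<noteq> 0" and k: "filterlim k at_top sequentially"
    and lim: "(\<lambda>i. D (k i)) \<longlonglongrightarrow> \<sigma>"
    and top: "\<And>\<delta>. 0 < \<delta> \<Longrightarrow> \<forall>\<^sub>F n in at_top. \<bar>D n\<bar> \<le> \<bar>\<sigma>\<bar> + \<delta>"
    using limsup_sequence_int[of D, OF Db] nz unfolding D_def[symmetric] by metis
  have ss: "s ^ j * s ^ j = 1" for j
    using s1 by (metis abs_mult_self_eq mult_1_right power_mult_distrib power_one)
  \<comment> \<open>The value \<open>s ^ j * \<sigma>\<close> is again of extreme modulus, so propagation can be iterated.\<close>
  have step: "(\<lambda>i. D (k i - int j * y)) \<longlonglongrightarrow> s ^ j * \<sigma>" for j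
  proof (induction j)
    case 0 then show ?case using lim by simp
  next
    case (Suc j)
    have abs: "\<bar>s ^ j * \<sigma>\<bar> = \<bar>\<sigma>\<bar>" using s1 by (simp add: abs_mult power_abs)
    have "filterlim (\<lambda>i. k i - int j * y) at_top sequentially"
      by (rule filterlim_compose[OF filterlim_minus_const_int_at_top k])
    from extremal_value_propagates[OF X e e1 Db Dh _ this Suc pos]
    have "(\<lambda>i. D (k i - int j * y - y)) \<longlonglongrightarrow> s * (s ^ j * \<sigma>)"
      using top \<sigma> s1 unfolding abs by force
    then show ?case by (simp add: algebra_simps)
  qed
  have tele: "h n - s ^ J * h (n - int J * y) = (\<Sum>j<J. s ^ j * D (n - int j * y))" for n J
    by (induction J) (auto simp: D_def algebra_simps)
  have "real J * \<bar>\<sigma>\<bar> \<le> 2 * B" for J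
  proof -
    have "(\<lambda>i. \<Sum>j<J. s ^ j * D (k i - int j * y)) \<longlonglongrightarrow> (\<Sum>j<J. s ^ j * (s ^ j * \<sigma>))"
      by (intro tendsto_intros step)
    also have "(\<Sum>j<J. s ^ j * (s ^ j * \<sigma>)) = real J * \<sigma>"
      by (simp add: mult.assoc[symmetric] ss)
    finally have "(\<lambda>i. \<bar>h (k i) - s ^ J * h (k i - int J * y)\<bar>) \<longlonglongrightarrow> \<bar>real J * \<sigma>\<bar>"
      unfolding tele by (rule tendsto_rabs)
    moreover have "\<bar>h n - s ^ J * h (n - int J * y)\<bar> \<le> 2 * B" for n
    proof -
      have "\<bar>s ^ J * h (n - int J * y)\<bar> \<le> B"
        using bdd[of "n - int J * y"] s1 by (simp add: abs_mult power_abs)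
      with bdd[of n] show ?thesis by linarith
    qed
    ultimately have "\<bar>real J * \<sigma>\<bar> \<le> 2 * B" by (intro LIMSEQ_le_const2) auto
    then show ?thesis by (simp add: abs_mult)
  qed
  moreover obtain J :: nat where "2 * B < real J * \<bar>\<sigma>\<bar>"
    using reals_Archimedean3[of "\<bar>\<sigma>\<bar>"] \<sigma> by auto
  ultimately show False by (meson not_less)
qed

lemma int_subgroup_cyclic:
  fixes A :: "int set"
  assumes "0 \<in> A" and diff: "\<And>a b. a \<in> A \<Longrightarrow> b \<in> A \<Longrightarrow> a - b \<in> A"
  obtains d where "d \<in> A" "\<And>a. a \<in> A \<Longrightarrow> d dvd a"
proof -
  have neg: "- a \<in> A" if "a \<in> A" for a using diff[OF \<open>0 \<in> A\<close> that] by simp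
  have add: "a + b \<in> A" if "a \<in> A" "b \<in> A" for a b using diff[OF that(1) neg[OF that(2)]] by simp
  have mult: "k * a \<in> A" if "a \<in> A" for a k :: int
  proof (induction k rule: int_induct[where k = 0])
    case base then show ?case using \<open>0 \<in> A\<close> by simp
  next
    case (step1 i) then show ?case using add that by (simp add: distrib_right)
  next
    case (step2 i) then show ?case using diff that by (simp add: left_diff_distrib)
  qed
  show thesis
  proof (cases "A = {0}")
    case True then show ?thesis using that[of 0] by simp
  next
    case False
    then obtain a where "a \<in> A" "a \<noteq> 0" using \<open>0 \<in> A\<close> by auto
    then have "int (nat \<bar>a\<bar>) \<in> A \<and> 0 < nat \<bar>a\<bar>" using neg by (auto simp: abs_if)
    then have ex: "\<exists>n. int n \<in> A \<and> 0 < n" by blast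
    define n where "n = (LEAST n. int n \<in> A \<and> 0 < n)"
    have n: "int n \<in> A" "0 < n" using LeastI_ex[OF ex] by (auto simp: n_def)
    have "int n dvd b" if "b \<in> A" for b
    proof -
      have "b mod int n = b - (b div int n) * int n" by (simp add: minus_div_mult_eq_mod)
      then have "b mod int n \<in> A" using diff[OF that mult[OF n(1)]] by simp
      moreover have "0 \<le> b mod int n" "b mod int n < int n" using n by auto
      ultimately have "b mod int n = 0"
        using not_less_Least[of "nat (b mod int n)" "\<lambda>n. int n \<in> A \<and> 0 < n"]
        unfolding n_def[symmetric] by auto
      then show ?thesis by auto
    qed
    with n show ?thesis using that by blast
  qed
qed

lemma (in prob_space) AE_atom:
  assumes X: "\<And>y. y \<in> V \<Longrightarrow> {w \<in> space M. X w = y} \<in> events"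
    and V: "countable V" "\<And>w. X w \<in> V"
  shows "AE x in M. prob {w \<in> space M. X w = X x} > 0"
proof -
  have "AE x in M. X x = y \<longrightarrow> prob {w \<in> space M. X w = y} > 0" if "y \<in> V" for y
  proof (cases "prob {w \<in> space M. X w = y} > 0")
    case False
    then have "prob {w \<in> space M. X w = y} = 0" using measure_nonneg[of M "{w \<in> space M. X w = y}"] by linarith
    then have "AE x in M. x \<notin> {w \<in> space M. X w = y}"
      using X[OF that] by (intro AE_not_in) (auto simp: null_sets_def emeasure_eq_measure)
    with AE_space show ?thesis by eventually_elim auto
  qed auto
  then have "AE x in M. \<forall>y\<in>V. X x = y \<longrightarrow> prob {w \<in> space M. X w = y} > 0"
    unfolding AE_ball_countable[OF V(1)] by blast
  then show ?thesis by eventually_elim (use V(2) in blast)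
qed

text \<open>A subgroup of the integers is cyclic, so its generator divides almost every value of \<open>X\<close>; by
  \<open>span\<close> only a unit does.\<close>

lemma subgroup_containing_span:
  fixes A :: "int set"
  assumes 0: "0 \<in> A" and diff: "\<And>a b. a \<in> A \<Longrightarrow> b \<in> A \<Longrightarrow> a - b \<in> A"
    and X: "AE x in M. X x \<in> A" and span: "\<And>d. (AE x in M. d dvd X x) \<Longrightarrow> d dvd 1"
  shows "1 \<in> A"
proof -
  obtain d where d: "d \<in> A" "\<And>a. a \<in> A \<Longrightarrow> d dvd a"
    using int_subgroup_cyclic[OF 0 diff] by blast
  have "AE x in M. d dvd X x" using X by eventually_elim (rule d(2))
  then have "d dvd 1" by (rule span)
  then show ?thesis using d(1) diff[OF 0 d(1)] by (auto simp: zdvd1_eq abs_if split: if_splits)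
qed

text \<open>Signed asymptotic periods form a group: shift both relations by \<open>b\<close> and eliminate \<open>h(n + b)\<close>.\<close>

lemma asymptotic_period_diff:
  fixes h :: "int \<Rightarrow> real"
  assumes a: "((\<lambda>n. h n - s * h (n - a)) \<longlongrightarrow> 0) at_top" and b: "((\<lambda>n. h n - s' * h (n - b)) \<longlongrightarrow> 0) at_top"
    and s': "s' * s' = 1"
  shows "((\<lambda>n. h n - (s * s') * h (n - (a - b))) \<longlongrightarrow> 0) at_top"
proof -
  have "((\<lambda>n. h (n - (- b)) - s' * h (n - (- b) - b)) \<longlongrightarrow> 0) at_top"
    by (rule filterlim_compose[OF b filterlim_minus_const_int_at_top])
  moreover have "((\<lambda>n. h (n - (- b)) - s * h (n - (- b) - a)) \<longlongrightarrow> 0) at_top"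
    by (rule filterlim_compose[OF a filterlim_minus_const_int_at_top])
  ultimately have "((\<lambda>n. s' * ((h (n - (- b)) - s * h (n - (- b) - a)) - (h (n - (- b)) - s' * h (n - (- b) - b)))) \<longlongrightarrow> s' * (0 - 0)) at_top"
    by (intro tendsto_intros)
  moreover have "s' * ((h (n - (- b)) - s * h (n - (- b) - a)) - (h (n - (- b)) - s' * h (n - (- b) - b)))
      = (s' * s') * h n - (s * s') * h (n - (a - b))" for n
    by (simp add: algebra_simps)
  ultimately show ?thesis by (simp add: s')
qed

text \<open>The signed periods \<open>(y, s)\<close> of \<open>h\<close> form a subgroup of \<open>\<int> \<times> {1, -1}\<close> that contains every atom of
  \<open>(X, e)\<close> and projects onto \<open>\<int>\<close>. If it contains two signs over the same \<open>y\<close>, then \<open>(0, -1)\<close> is a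
  period and \<open>2 h\<close> tends to \<open>0\<close>. Otherwise it is the graph of a homomorphism \<open>y \<mapsto> s\<^sup>y\<close>, and \<open>e\<close>
  equals that character of \<open>X\<close>, which \<open>free\<close> excludes.\<close>

lemma (in prob_space) signed_liouville:
  fixes h :: "int \<Rightarrow> real" and X :: "'a \<Rightarrow> int" and e :: "'a \<Rightarrow> real"
  assumes X [measurable]: "X \<in> M \<rightarrow>\<^sub>M count_space UNIV" and e [measurable]: "e \<in> borel_measurable M"
    and e1: "\<And>x. \<bar>e x\<bar> = 1"
    and bdd: "\<And>n. \<bar>h n\<bar> \<le> B"
    and harm: "((\<lambda>n. h n - expectation (\<lambda>x. e x * h (n - X x))) \<longlongrightarrow> 0) at_top"
    and span: "\<And>d. (AE x in M. d dvd X x) \<Longrightarrow> d dvd 1"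
    and free: "\<And>s. s \<in> {1, -1} \<Longrightarrow> \<not> (AE x in M. e x = s powi X x)"
  shows "(h \<longlongrightarrow> 0) at_top"
proof (rule ccontr)
  assume nz: "\<not> (h \<longlongrightarrow> 0) at_top"
  define P where "P y s \<longleftrightarrow> s \<in> {1, -1} \<and> ((\<lambda>n. h n - s * h (n - y)) \<longlongrightarrow> 0) at_top" for y s
  have P0: "P 0 1" by (simp add: P_def)
  have diff: "P (a - b) (s * s')" if "P a s" "P b s'" for a b s s'
    using that asymptotic_period_diff[of h s a s' b] by (auto simp: P_def)
  have uniq: "s = s'" if "P a s" "P a s'" for a s s'
  proof (rule ccontr)
    assume "s \<noteq> s'"
    then have "P 0 (-1)" using diff[OF that] that by (auto simp: P_def)
    then have "((\<lambda>n. (h n - (-1) * h (n - 0)) / 2) \<longlongrightarrow> 0 / 2) at_top"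
      unfolding P_def by (intro tendsto_intros) auto
    with nz show False by simp
  qed
  have e_cases: "e x = 1 \<or> e x = -1" for x using e1[of x] by (auto simp: abs_if split: if_splits)
  have "AE x in M. prob {w \<in> space M. (X w, e w) = (X x, e x)} > 0"
    by (rule AE_atom[where V = "UNIV \<times> {1, -1}"]) (use e_cases in auto)
  then have supp: "AE x in M. P (X x) (e x)"
  proof eventually_elim
    case (elim x)
    then have "((\<lambda>n. h n - e x * h (n - X x)) \<longlongrightarrow> 0) at_top"
      by (intro asymptotic_liouville[OF X e e1 bdd harm]) simp
    then show ?case using e_cases[of x] by (simp add: P_def)
  qed
  have "1 \<in> {y. \<exists>s. P y s}"
  proof (rule subgroup_containing_span[OF _ _ _ span])
    show "AE x in M. X x \<in> {y. \<exists>s. P y s}" using supp by eventually_elim blast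
  qed (use P0 diff in blast)+
  then obtain s where s: "P 1 s" by blast
  have s1: "s = 1 \<or> s = -1" using s by (simp add: P_def)
  have pow: "P k (s powi k)" for k
  proof (induction k rule: int_induct[where k = 0])
    case base then show ?case using P0 by simp
  next
    case (step1 i)
    from diff[OF step1(2) diff[OF P0 s]] show ?case using s1 by (auto simp: power_int_add_1)
  next
    case (step2 i)
    from diff[OF step2(2) s] show ?case using s1 by (auto simp: power_int_diff)
  qed
  have "AE x in M. e x = s powi X x" using supp by eventually_elim (rule uniq[OF _ pow])
  with free[of s] s1 show False by auto
qed

section \<open>Backward sums of integer sequences\<close>

lemma int_at_top_eq: "(at_top :: int filter) = filtermap int sequentially"
proof (rule filter_eqI)
  fix P :: "int \<Rightarrow> bool"
  show "eventually P at_top \<longleftrightarrow> eventually P (filtermap int sequentially)"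
  proof
    assume "eventually P at_top"
    then show "eventually P (filtermap int sequentially)"
      unfolding eventually_filtermap
      by (rule eventually_compose_filterlim[OF _ filterlim_int_sequentially])
  next
    assume "eventually P (filtermap int sequentially)"
    then obtain m where m: "\<forall>n\<ge>m. P (int n)"
      unfolding eventually_filtermap eventually_sequentially by blast
    have "P z" if "z \<ge> int m" for z
    proof -
      have "z = int (nat z)" "m \<le> nat z" using that by auto
      then show ?thesis using m by metis
    qed
    then show "eventually P at_top" unfolding eventually_at_top_linorder by blast
  qed
qed

lemma tendsto_int_at_top_iff: "(f \<longlongrightarrow> L) (at_top :: int filter) \<longleftrightarrow> (\<lambda>i. f (int i)) \<longlonglongrightarrow> L"
  unfolding int_at_top_eq by (simp add: filterlim_filtermap)

lemma backward_sums_tendsto: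
  fixes g :: "int \<Rightarrow> real"
  assumes g: "integrable (count_space UNIV) g"
  shows "summable (\<lambda>i. g (n - int i))"
    and "((\<lambda>n. \<Sum>i. g (n - int i)) \<longlongrightarrow> (\<integral>z. g z \<partial>count_space UNIV)) at_top"
proof -
  have abs: "Infinite_Set_Sum.abs_summable_on g A" for A
  proof (rule Infinite_Set_Sum.abs_summable_on_subset[of g UNIV])
    show "Infinite_Set_Sum.abs_summable_on g UNIV"
      using g by (simp add: Infinite_Set_Sum.abs_summable_on_def)
  qed simp
  have bij: "bij_betw (\<lambda>i. n - int i) UNIV {..n}" for n
    by (rule bij_betw_byWitness[where f' = "\<lambda>z. nat (n - z)"]) auto
  have abs': "Infinite_Set_Sum.abs_summable_on (\<lambda>i. g (n - int i)) UNIV" for n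
    using abs abs_summable_on_reindex_bij_betw[OF bij, of g n] by blast
  then show "summable (\<lambda>i. g (n - int i))"
    by (auto simp: abs_summable_on_nat_iff' intro: summable_rabs_cancel)
  have eq: "(\<Sum>i. g (n - int i)) = (\<integral>z. indicator {..n} z *\<^sub>R g z \<partial>count_space UNIV)" for n
  proof -
    have "(\<Sum>i. g (n - int i)) = infsetsum (\<lambda>i. g (n - int i)) UNIV"
      using infsetsum_nat'[OF abs'] by simp
    also have "\<dots> = infsetsum g {..n}" by (rule infsetsum_reindex_bij_betw[OF bij])
    finally show ?thesis by (simp add: infsetsum_altdef set_lebesgue_integral_def)
  qed
  have "(\<lambda>i. \<integral>z. indicator {..int i} z *\<^sub>R g z \<partial>count_space UNIV) \<longlonglongrightarrow> (\<integral>z. g z \<partial>count_space UNIV)"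
  proof (rule integral_dominated_convergence[where w = "\<lambda>z. \<bar>g z\<bar>"])
    show "AE z in count_space UNIV. (\<lambda>i. indicator {..int i} z *\<^sub>R g z) \<longlonglongrightarrow> g z"
    proof (rule AE_I2)
      fix z :: int
      have "\<forall>\<^sub>F i in sequentially. indicator {..int i} z *\<^sub>R g z = g z"
        using eventually_ge_at_top[of "nat z"] by eventually_elim (auto simp: indicator_def)
      then show "(\<lambda>i. indicator {..int i} z *\<^sub>R g z) \<longlonglongrightarrow> g z" by (rule tendsto_eventually)
    qed
  qed (use g in \<open>auto simp: indicator_def\<close>)
  then show "((\<lambda>n. \<Sum>i. g (n - int i)) \<longlongrightarrow> (\<integral>z. g z \<partial>count_space UNIV)) at_top"
    by (simp add: tendsto_int_at_top_iff eq)
qed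

lemma integrable_int_tendsto_zero:
  fixes g :: "int \<Rightarrow> real"
  assumes g: "integrable (count_space UNIV) g"
  shows "(g \<longlongrightarrow> 0) at_top"
proof -
  let ?G = "\<lambda>n. \<Sum>i. g (n - int i)"
  have "?G n - ?G (n - 1) = g n" for n
    using suminf_split_head[OF backward_sums_tendsto(1)[OF g], of n] by (simp add: algebra_simps)
  moreover have "((\<lambda>n. ?G n - ?G (n - 1)) \<longlongrightarrow> (\<integral>z. g z \<partial>count_space UNIV) - (\<integral>z. g z \<partial>count_space UNIV)) at_top"
    by (intro tendsto_diff backward_sums_tendsto[OF g] filterlim_compose[OF backward_sums_tendsto(2)[OF g] filterlim_minus_const_int_at_top])
  ultimately show ?thesis by simp
qed

section \<open>A renewal theorem for two-sided integer walks\<close>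

text \<open>The contraction \<open>E[exp (- \<theta> X)] < 1\<close> encodes the upward drift: it makes the walk transient to
  \<open>+\<infinity>\<close> at a geometric rate, whether or not \<open>X\<close> has a finite mean.\<close>

locale drifting_walk = prob_space Q for Q :: "'b measure" +
  fixes X :: "'b \<Rightarrow> int" and \<theta> :: real
  assumes X [measurable]: "X \<in> Q \<rightarrow>\<^sub>M count_space UNIV"
    and theta: "0 < \<theta>"
    and exp_integrable: "integrable Q (\<lambda>x. exp (- \<theta> * X x))"
    and exp_less: "expectation (\<lambda>x. exp (- \<theta> * X x)) < 1"
begin

definition \<phi> :: real where "\<phi> = expectation (\<lambda>x. exp (- \<theta> * X x))"

lemma phi_less: "\<phi> < 1"
  using exp_less by (simp add: \<phi>_def)

lemma phi_nonneg: "0 \<le> \<phi>"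
  unfolding \<phi>_def by (intro integral_nonneg_AE) auto

lemma integrable_shift:
  fixes r :: "int \<Rightarrow> real"
  assumes "\<And>n. \<bar>r n\<bar> \<le> K * exp (\<theta> * n)"
  shows "integrable Q (\<lambda>x. r (n - X x))"
proof (rule Bochner_Integration.integrable_bound)
  show "integrable Q (\<lambda>x. K * exp (\<theta> * n) * exp (- \<theta> * X x))"
    using exp_integrable by simp
  show "AE x in Q. norm (r (n - X x)) \<le> norm (K * exp (\<theta> * n) * exp (- \<theta> * X x))"
  proof (rule AE_I2)
    fix x
    have "\<bar>r (n - X x)\<bar> \<le> K * exp (\<theta> * n) * exp (- \<theta> * X x)"
      using assms[of "n - X x"] by (simp add: algebra_simps flip: exp_add)
    then show "norm (r (n - X x)) \<le> norm (K * exp (\<theta> * n) * exp (- \<theta> * X x))"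
      by simp
  qed
qed simp

lemma expectation_exp_shift: "expectation (\<lambda>x. exp (\<theta> * of_int (n - X x))) = \<phi> * exp (\<theta> * of_int n)"
proof -
  have "expectation (\<lambda>x. exp (\<theta> * of_int (n - X x))) = expectation (\<lambda>x. exp (\<theta> * n) * exp (- \<theta> * X x))"
    by (intro Bochner_Integration.integral_cong) (auto simp: algebra_simps simp flip: exp_add)
  then show ?thesis by (simp add: \<phi>_def)
qed

text \<open>A bounded function whose defect \<open>barrier n - E[barrier (n - X)]\<close> is nonnegative everywhere and at
  least \<open>1\<close> at \<open>0\<close>. It dominates the Green function of the walk.\<close>

definition barrier :: "int \<Rightarrow> real" where
  "barrier n = min 1 (exp (\<theta> * of_int n)) / (1 - \<phi>)"

lemma barrier_nonneg: "0 \<le> barrier n"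
  using phi_less by (simp add: barrier_def)

lemma barrier_le: "barrier n \<le> 1 / (1 - \<phi>)"
  using phi_less by (simp add: barrier_def divide_right_mono)

text \<open>The mean of \<open>min 1 (exp (\<theta> (n - X)))\<close> is at most \<open>1\<close> and at most \<open>\<phi> exp (\<theta> n)\<close>. At \<open>n = 0\<close> the
  second bound leaves the gap \<open>1 - \<phi>\<close>, which the normalisation of \<open>barrier\<close> scales to \<open>1\<close>.\<close>

lemma barrier_superharmonic:
  "expectation (\<lambda>x. barrier (n - X x)) + (if n = 0 then 1 else 0) \<le> barrier n"
proof -
  have int: "integrable Q (\<lambda>x. min 1 (exp (\<theta> * of_int (n - X x))))"
    by (rule integrable_const_bound[of _ 1]) auto
  have eq: "expectation (\<lambda>x. barrier (n - X x)) =
      expectation (\<lambda>x. min 1 (exp (\<theta> * of_int (n - X x)))) / (1 - \<phi>)"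
    by (simp add: barrier_def)
  have le1: "expectation (\<lambda>x. min 1 (exp (\<theta> * of_int (n - X x)))) \<le> 1"
    by (rule integral_le_const[OF int]) auto
  have le2: "expectation (\<lambda>x. min 1 (exp (\<theta> * of_int (n - X x)))) \<le> \<phi> * exp (\<theta> * of_int n)"
    unfolding expectation_exp_shift[symmetric]
    by (intro integral_mono int integrable_shift[of "\<lambda>n. exp (\<theta> * of_int n)" 1]) auto
  have "expectation (\<lambda>x. min 1 (exp (\<theta> * of_int (n - X x)))) + (if n = 0 then 1 - \<phi> else 0)
      \<le> min 1 (exp (\<theta> * of_int n))"
  proof (cases "n = 0")
    case True with le2 show ?thesis by simp
  next
    case False
    have "\<phi> * exp (\<theta> * of_int n) \<le> exp (\<theta> * of_int n)"
      using phi_less by (simp add: mult_le_cancel_right1)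
    with le2 have "expectation (\<lambda>x. min 1 (exp (\<theta> * of_int (n - X x)))) \<le> exp (\<theta> * of_int n)"
      by linarith
    with le1 False show ?thesis by simp
  qed
  then have "(expectation (\<lambda>x. min 1 (exp (\<theta> * of_int (n - X x)))) + (if n = 0 then 1 - \<phi> else 0)) / (1 - \<phi>)
      \<le> min 1 (exp (\<theta> * of_int n)) / (1 - \<phi>)"
    using phi_less by (intro divide_right_mono) auto
  then show ?thesis
    unfolding eq using phi_less by (simp add: barrier_def add_divide_distrib split: if_splits)
qed

text \<open>The convolution \<open>G\<close> of \<open>\<bar>g\<bar>\<close> with \<open>barrier\<close> is a bounded supersolution. The positive part of \<open>r - G\<close>
  is then subharmonic and of growth \<open>exp (\<theta> n)\<close>; since averaging multiplies \<open>exp (\<theta> n)\<close> by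
  \<open>\<phi> < 1\<close>, it vanishes.\<close>

lemma subsolution_bounded:
  fixes r g :: "int \<Rightarrow> real"
  assumes g: "integrable (count_space UNIV) g"
    and r0: "\<And>n. 0 \<le> r n" and rK: "\<And>n. r n \<le> K * exp (\<theta> * n)"
    and sub: "\<And>n. r n \<le> \<bar>g n\<bar> + expectation (\<lambda>x. r (n - X x))"
  shows "r n \<le> (\<integral>z. \<bar>g z\<bar> \<partial>count_space UNIV) / (1 - \<phi>)"
proof -
  have g': "integrable (count_space UNIV) (\<lambda>z. \<bar>g z\<bar>)" using g by simp
  let ?S = "\<integral>z. \<bar>g z\<bar> \<partial>count_space UNIV"
  define G where "G n = (\<integral>z. \<bar>g z\<bar> * barrier (n - z) \<partial>count_space UNIV)" for n
  have b1: "\<bar>g z\<bar> * barrier m \<le> \<bar>g z\<bar> * (1 / (1 - \<phi>))" for z m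
    by (intro mult_left_mono barrier_le) auto
  have Gint: "integrable (count_space UNIV) (\<lambda>z. \<bar>g z\<bar> * barrier (n - z))" for n
    by (rule Bochner_Integration.integrable_bound[OF integrable_mult_left[OF g', of "1 / (1 - \<phi>)"]])
      (use b1 barrier_nonneg phi_less in \<open>auto simp: abs_mult\<close>)
  have G0: "0 \<le> G n" for n unfolding G_def by (intro integral_nonneg_AE) (auto simp: barrier_nonneg)
  have GS: "G n \<le> ?S / (1 - \<phi>)" for n
  proof -
    have "G n \<le> (\<integral>z. \<bar>g z\<bar> * (1 / (1 - \<phi>)) \<partial>count_space UNIV)" unfolding G_def
      by (intro integral_mono Gint integrable_mult_left g' b1)
    then show ?thesis by simp
  qed
  have bint: "integrable Q (\<lambda>x. barrier (n - X x))" for n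
    by (rule integrable_const_bound[of _ "1 / (1 - \<phi>)"]) (auto simp: barrier_nonneg barrier_le)
  have Gnn: "ennreal (G n) = (\<integral>\<^sup>+z. ennreal (\<bar>g z\<bar> * barrier (n - z)) \<partial>count_space UNIV)" for n
    unfolding G_def by (rule nn_integral_eq_integral[symmetric, OF Gint]) (auto simp: barrier_nonneg)
  have GQ: "integrable Q (\<lambda>x. G (n - X x))" for n
    by (rule integrable_const_bound[of _ "?S / (1 - \<phi>)"]) (auto simp: G0 GS)
  have Gsuper: "expectation (\<lambda>x. G (n - X x)) + \<bar>g n\<bar> \<le> G n" for n
  proof -
    have "ennreal (expectation (\<lambda>x. G (n - X x))) = (\<integral>\<^sup>+x. ennreal (G (n - X x)) \<partial>Q)"
      by (rule nn_integral_eq_integral[symmetric, OF GQ]) (auto simp: G0)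
    also have "\<dots> = (\<integral>\<^sup>+x. (\<integral>\<^sup>+z. ennreal (\<bar>g z\<bar> * barrier (n - X x - z)) \<partial>count_space UNIV) \<partial>Q)"
      by (simp add: Gnn)
    also have "\<dots> = (\<integral>\<^sup>+z. (\<integral>\<^sup>+x. ennreal (\<bar>g z\<bar> * barrier (n - X x - z)) \<partial>Q) \<partial>count_space UNIV)"
      by (rule nn_integral_count_space_nn_integral) auto
    also have "\<dots> = (\<integral>\<^sup>+z. ennreal (\<bar>g z\<bar> * expectation (\<lambda>x. barrier ((n - z) - X x))) \<partial>count_space UNIV)"
    proof (intro nn_integral_cong)
      fix z
      have "(\<integral>\<^sup>+x. ennreal (\<bar>g z\<bar> * barrier (n - X x - z)) \<partial>Q)
        = (\<integral>\<^sup>+x. ennreal (\<bar>g z\<bar> * barrier ((n - z) - X x)) \<partial>Q)"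
        by (simp add: algebra_simps)
      also have "\<dots> = ennreal (expectation (\<lambda>x. \<bar>g z\<bar> * barrier ((n - z) - X x)))"
        by (rule nn_integral_eq_integral) (auto simp: barrier_nonneg intro!: bint)
      finally show "(\<integral>\<^sup>+x. ennreal (\<bar>g z\<bar> * barrier (n - X x - z)) \<partial>Q) =
          ennreal (\<bar>g z\<bar> * expectation (\<lambda>x. barrier ((n - z) - X x)))" by simp
    qed
    finally have 1: "ennreal (expectation (\<lambda>x. G (n - X x))) =
      (\<integral>\<^sup>+z. ennreal (\<bar>g z\<bar> * expectation (\<lambda>x. barrier ((n - z) - X x))) \<partial>count_space UNIV)" .
    have 2: "ennreal \<bar>g n\<bar> = (\<integral>\<^sup>+z. ennreal (\<bar>g z\<bar> * (if n - z = 0 then 1 else 0)) \<partial>count_space UNIV)"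
    proof -
      have "(\<integral>\<^sup>+z. ennreal (\<bar>g z\<bar> * (if n - z = 0 then 1 else 0)) \<partial>count_space UNIV)
        = (\<integral>\<^sup>+z. ennreal \<bar>g n\<bar> * indicator {n} z \<partial>count_space UNIV)"
        by (intro nn_integral_cong) (auto simp: indicator_def)
      then show ?thesis by simp
    qed
    have "ennreal (expectation (\<lambda>x. G (n - X x)) + \<bar>g n\<bar>) =
      (\<integral>\<^sup>+z. ennreal (\<bar>g z\<bar> * (expectation (\<lambda>x. barrier ((n - z) - X x)) + (if n - z = 0 then 1 else 0))) \<partial>count_space UNIV)"
      (is "?l = ?r")
    proof -
      have "?l = ennreal (expectation (\<lambda>x. G (n - X x))) + ennreal \<bar>g n\<bar>"
        by (intro ennreal_plus) (auto intro!: integral_nonneg_AE simp: G0)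
      also have "\<dots> = ?r" unfolding 1 2
        by (subst nn_integral_add[symmetric])
          (auto intro!: nn_integral_cong ennreal_plus[symmetric] mult_nonneg_nonneg integral_nonneg_AE
            simp: barrier_nonneg distrib_left simp del: ennreal_plus)
      finally show ?thesis .
    qed
    also have "\<dots> \<le> (\<integral>\<^sup>+z. ennreal (\<bar>g z\<bar> * barrier (n - z)) \<partial>count_space UNIV)"
      by (intro nn_integral_mono ennreal_leI mult_left_mono barrier_superharmonic) auto
    also have "\<dots> = ennreal (G n)" by (simp add: Gnn)
    finally show ?thesis using G0 by (simp add: ennreal_le_iff del: ennreal_plus)
  qed
  define u where "u n = max 0 (r n - G n)" for n
  have K0: "0 \<le> K" using r0[of 0] rK[of 0] by simp
  have uK: "\<bar>u n\<bar> \<le> K * exp (\<theta> * n)" for n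
    using rK[of n] G0[of n] K0 by (auto simp: u_def)
  have rint: "integrable Q (\<lambda>x. r (n - X x))" for n
    by (rule integrable_shift[of r K]) (use r0 rK in auto)
  have usub: "u n \<le> expectation (\<lambda>x. u (n - X x))" for n
  proof -
    have "r n - G n \<le> expectation (\<lambda>x. r (n - X x) - G (n - X x))"
      using sub[of n] Gsuper[of n] by (simp add: Bochner_Integration.integral_diff[OF rint GQ])
    also have "\<dots> \<le> expectation (\<lambda>x. u (n - X x))"
      by (intro integral_mono Bochner_Integration.integrable_diff rint GQ integrable_shift[of u K] uK)
         (auto simp: u_def)
    moreover have "0 \<le> expectation (\<lambda>x. u (n - X x))"
      by (intro integral_nonneg_AE) (auto simp: u_def)
    ultimately show ?thesis unfolding u_def by simp
  qed
  have "u n \<le> K * \<phi> ^ m * exp (\<theta> * n)" for m n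
  proof (induction m arbitrary: n)
    case 0 then show ?case using uK[of n] by auto
  next
    case (Suc m)
    have "u n \<le> expectation (\<lambda>x. u (n - X x))" by (rule usub)
    also have "\<dots> \<le> expectation (\<lambda>x. K * \<phi> ^ m * exp (\<theta> * of_int (n - X x)))"
      by (intro integral_mono integrable_shift[of u K] uK Suc integrable_mult_right
          integrable_shift[of "\<lambda>n. exp (\<theta> * of_int n)" 1]) auto
    also have "\<dots> = K * \<phi> ^ Suc m * exp (\<theta> * n)"
      by (simp only: integral_mult_right_zero expectation_exp_shift) simp
    finally show ?case .
  qed
  moreover have "(\<lambda>m. K * \<phi> ^ m * exp (\<theta> * n)) \<longlonglongrightarrow> K * 0 * exp (\<theta> * n)"
    by (intro tendsto_intros LIMSEQ_power_zero) (use phi_nonneg phi_less in auto)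
  ultimately have "u n \<le> K * 0 * exp (\<theta> * n)" by (intro LIMSEQ_le_const) blast+
  then have "u n \<le> 0" by simp
  then show ?thesis using GS[of n] by (auto simp: u_def)
qed


lemma summable_backward:
  fixes r :: "int \<Rightarrow> real"
  assumes "\<And>n. \<bar>r n\<bar> \<le> K * exp (\<theta> * n)"
  shows "summable (\<lambda>i. r (n - int i))"
proof (rule summable_comparison_test')
  show "summable (\<lambda>i. K * exp (\<theta> * n) * exp (- \<theta>) ^ i)"
    using theta by (intro summable_mult summable_geometric) simp
  show "norm (r (n - int i)) \<le> K * exp (\<theta> * n) * exp (- \<theta>) ^ i" if "i \<ge> 0" for i
    using assms[of "n - int i"] by (simp add: algebra_simps flip: exp_add exp_of_nat_mult)
qed

lemma integrable_neg_part: "integrable Q (\<lambda>x. max 0 (- real_of_int (X x)))"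
proof (rule Bochner_Integration.integrable_bound)
  show "integrable Q (\<lambda>x. exp (- \<theta> * X x) / \<theta>)" using exp_integrable by simp
  show "AE x in Q. norm (max 0 (- real_of_int (X x))) \<le> norm (exp (- \<theta> * X x) / \<theta>)"
  proof (rule AE_I2)
    fix x
    have "- \<theta> * X x \<le> exp (- \<theta> * X x)" using exp_ge_add_one_self[of "- \<theta> * X x"] by linarith
    then have "- X x \<le> exp (- \<theta> * X x) / \<theta>" using theta by (simp add: field_simps)
    moreover have "0 \<le> exp (- \<theta> * X x) / \<theta>" using theta by simp
    ultimately show "norm (max 0 (- real_of_int (X x))) \<le> norm (exp (- \<theta> * X x) / \<theta>)" using theta by simp
  qed
qed measurable

text \<open>A nonnegative solution of the renewal equation in the growth class \<open>exp (\<theta> n)\<close>, on which averaging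
  over the step acts as a contraction.\<close>

context
  fixes r g :: "int \<Rightarrow> real" and K :: real
  assumes g: "integrable (count_space UNIV) g"
    and r0: "\<And>n. 0 \<le> r n" and rK: "\<And>n. r n \<le> K * exp (\<theta> * n)"
    and renewal: "\<And>n. r n = g n + expectation (\<lambda>x. r (n - X x))"
begin

definition cum_r where "cum_r n = (\<Sum>i. r (n - int i))"

lemma renewal_bounded: obtains B where "0 \<le> B" "\<And>n. r n \<le> B"
proof (rule that)
  let ?B = "(\<integral>z. \<bar>g z\<bar> \<partial>count_space UNIV) / (1 - \<phi>)"
  show "r n \<le> ?B" for n
  proof (rule subsolution_bounded[OF g r0 rK])
    show "r n \<le> \<bar>g n\<bar> + expectation (\<lambda>x. r (n - X x))" for n
      using renewal[of n] by linarith
  qed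
  then show "0 \<le> ?B" using r0[of 0] by (meson order_trans)
qed

lemma summable_r: "summable (\<lambda>i. r (n - int i))"
  by (rule summable_backward) (use r0 rK in auto)

lemma cum_r_step: "cum_r n - cum_r (n - 1) = r n"
  unfolding cum_r_def using suminf_split_head[OF summable_r, of n] by (simp add: algebra_simps)

lemma cum_r_mono: assumes "m \<le> n" shows "cum_r m \<le> cum_r n"
  using assms
proof (induction n rule: int_ge_induct)
  case (step i)
  have "cum_r (i + 1) - cum_r i = r (i + 1)" using cum_r_step[of "i + 1"] by simp
  then show ?case using step.IH r0[of "i + 1"] by linarith
qed simp

text \<open>Summing the renewal equation over \<open>n, n - 1, \<dots>\<close> and exchanging sum and expectation, all terms
  \<open>r\<close> being nonnegative and geometrically summable towards \<open>- \<infinity>\<close>.\<close>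

lemma cum_r_renewal:
  "integrable Q (\<lambda>x. cum_r (n - X x))"
  "expectation (\<lambda>x. cum_r n - cum_r (n - X x)) = (\<Sum>i. g (n - int i))"
proof -
  have rint: "integrable Q (\<lambda>x. r (n - X x))" for n
    by (rule integrable_shift[of r K]) (use r0 rK in auto)
  have rint': "integrable Q (\<lambda>x. r (n - X x - int i))" for n i
    using rint[of "n - int i"] by (simp add: algebra_simps)
  have E: "expectation (\<lambda>x. r (n - X x - int i)) = r (n - int i) - g (n - int i)" for i n
    using renewal[of "n - int i"] by (simp add: algebra_simps)
  have sE: "summable (\<lambda>i. expectation (\<lambda>x. norm (r (n - X x - int i))))" for n
    using r0 by (simp add: E summable_diff summable_r backward_sums_tendsto(1)[OF g])
  have sr: "AE x in Q. summable (\<lambda>i. norm (r (n - X x - int i)))" for n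
    using r0 summable_r by simp
  show int: "integrable Q (\<lambda>x. cum_r (n - X x))" for n
    unfolding cum_r_def by (rule integrable_suminf[OF rint' sr sE])
  have "expectation (\<lambda>x. cum_r (n - X x)) = (\<Sum>i. r (n - int i) - g (n - int i))"
    unfolding cum_r_def E[symmetric] by (rule integral_suminf[OF rint' sr sE])
  also have "\<dots> = cum_r n - (\<Sum>i. g (n - int i))"
    unfolding cum_r_def by (rule suminf_diff[symmetric, OF summable_r backward_sums_tendsto(1)[OF g]])
  finally show "expectation (\<lambda>x. cum_r n - cum_r (n - X x)) = (\<Sum>i. g (n - int i))"
    using int[of n] by (simp add: prob_space)
qed

context
  assumes span: "\<And>d. (AE x in Q. d dvd X x) \<Longrightarrow> d dvd 1"
begin

text \<open>The equation makes \<open>r\<close> asymptotically harmonic, since \<open>g\<close> tends to \<open>0\<close>. The periods of \<open>r\<close> supplied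
  by the Liouville property form a subgroup that contains the steps, so every integer is one.\<close>

lemma slowly_varying: "((\<lambda>n. r n - r (n - y)) \<longlongrightarrow> 0) at_top"
proof -
  define A where "A = {y. ((\<lambda>n. r n - r (n - y)) \<longlongrightarrow> 0) at_top}"
  obtain B where B: "\<And>n. r n \<le> B" using renewal_bounded by blast
  have 0: "0 \<in> A" by (simp add: A_def)
  have sub: "a - b \<in> A" if "a \<in> A" "b \<in> A" for a b
    using asymptotic_period_diff[of r 1 a 1 b] that by (simp add: A_def)
  have "AE x in Q. prob {w \<in> space Q. X w = X x} > 0"
    by (rule AE_atom[where V = UNIV]) auto
  then have "AE x in Q. X x \<in> A"
  proof eventually_elim
    case (elim x)
    have "((\<lambda>n. r n - 1 * r (n - X x)) \<longlongrightarrow> 0) at_top"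
    proof (rule asymptotic_liouville[OF X, where e = "\<lambda>_. 1" and B = B])
      show "\<bar>r n\<bar> \<le> B" for n using r0 B by simp
      show "((\<lambda>n. r n - expectation (\<lambda>x. 1 * r (n - X x))) \<longlongrightarrow> 0) at_top"
        using integrable_int_tendsto_zero[OF g] by (subst renewal) simp
    qed (use elim in auto)
    then show ?case by (simp add: A_def)
  qed
  from subgroup_containing_span[OF 0 sub this span] have one: "1 \<in> A" .
  have "y \<in> A"
  proof (induction y rule: int_induct[where k = 0])
    case (step1 i) then show ?case using sub[OF step1(2) sub[OF 0 one]] by simp
  next
    case (step2 i) then show ?case using sub[OF step2(2) one] by simp
  qed (rule 0)
  then show ?thesis by (simp add: A_def)
qed

text \<open>The difference is a sum of \<open>y\<close> terms of the slowly varying \<open>r\<close>.\<close>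

lemma cum_r_linear: "((\<lambda>n. cum_r n - cum_r (n - y) - y * r n) \<longlongrightarrow> 0) at_top"
proof (induction y rule: int_induct[where k = 0])
  case base then show ?case by simp
next
  case (step1 i)
  have "((\<lambda>n. (cum_r n - cum_r (n - i) - i * r n) - (r n - r (n - i))) \<longlongrightarrow> 0 - 0) at_top"
    by (intro tendsto_diff step1 slowly_varying)
  moreover have "(cum_r n - cum_r (n - i) - i * r n) - (r n - r (n - i)) =
      cum_r n - cum_r (n - (i + 1)) - (i + 1) * r n" for n
    using cum_r_step[of "n - i"] by (simp add: algebra_simps)
  ultimately show ?case by simp
next
  case (step2 i)
  have "((\<lambda>n. (cum_r n - cum_r (n - i) - i * r n) + (r n - r (n - (i - 1)))) \<longlongrightarrow> 0 + 0) at_top"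
    by (intro tendsto_add step2 slowly_varying)
  moreover have "(cum_r n - cum_r (n - i) - i * r n) + (r n - r (n - (i - 1))) =
      cum_r n - cum_r (n - (i - 1)) - (i - 1) * r n" for n
    using cum_r_step[of "n - (i - 1)"] by (simp add: algebra_simps)
  ultimately show ?case by simp
qed

lemma cum_r_lipschitz:
  assumes B: "\<And>n. r n \<le> B"
  shows "\<bar>cum_r n - cum_r (n - y)\<bar> \<le> B * \<bar>real_of_int y\<bar>"
proof (induction y rule: int_induct[where k = 0])
  case base then show ?case by simp
next
  case (step1 i) then show ?case using cum_r_step[of "n - i"] r0[of "n - i"] B[of "n - i"]
    by (simp add: algebra_simps abs_if split: if_splits)
next
  case (step2 i) then show ?case
    using cum_r_step[of "n - (i - 1)"] r0[of "n - (i - 1)"] B[of "n - (i - 1)"]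
    by (simp add: algebra_simps abs_if split: if_splits)
qed

text \<open>Dominated convergence in \<open>cum_r_linear\<close>. The variable \<open>Y\<close> is the step itself or, if that has no
  mean, a truncation of it.\<close>

lemma cum_r_expectation:
  assumes Y [measurable]: "Y \<in> Q \<rightarrow>\<^sub>M count_space UNIV" and Yint: "integrable Q (\<lambda>x. real_of_int (Y x))"
  shows "integrable Q (\<lambda>x. cum_r n - cum_r (n - Y x))" (is ?A)
    and "((\<lambda>n. expectation (\<lambda>x. cum_r n - cum_r (n - Y x)) - r n * expectation (\<lambda>x. real_of_int (Y x)))
        \<longlongrightarrow> 0) at_top"
proof -
  obtain B where B: "0 \<le> B" "\<And>n. r n \<le> B" using renewal_bounded by blast
  have int: "integrable Q (\<lambda>x. cum_r n - cum_r (n - Y x))" for n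
    by (rule Bochner_Integration.integrable_bound[of _ "\<lambda>x. B * \<bar>real_of_int (Y x)\<bar>"])
       (use Yint cum_r_lipschitz[OF B(2)] in \<open>auto intro!: AE_I2 order_trans[OF _ abs_ge_self]\<close>)
  then show ?A .
  have "(\<lambda>i. expectation (\<lambda>x. cum_r (int i) - cum_r (int i - Y x) - Y x * r (int i))) \<longlonglongrightarrow> expectation (\<lambda>x. 0)"
  proof (rule integral_dominated_convergence[where w = "\<lambda>x. 2 * B * \<bar>real_of_int (Y x)\<bar>"])
    show "AE x in Q. (\<lambda>i. cum_r (int i) - cum_r (int i - Y x) - Y x * r (int i)) \<longlonglongrightarrow> 0"
      using cum_r_linear by (intro AE_I2) (simp add: tendsto_int_at_top_iff)
    show "AE x in Q. norm (cum_r (int i) - cum_r (int i - Y x) - Y x * r (int i)) \<le> 2 * B * \<bar>real_of_int (Y x)\<bar>" for i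
    proof (rule AE_I2)
      fix x
      have "\<bar>Y x * r (int i)\<bar> \<le> B * \<bar>real_of_int (Y x)\<bar>"
        using B r0[of "int i"] by (simp add: abs_mult mult.commute[of "\<bar>_\<bar>"] mult_right_mono)
      with cum_r_lipschitz[OF B(2), of "int i" "Y x"]
      show "norm (cum_r (int i) - cum_r (int i - Y x) - Y x * r (int i)) \<le> 2 * B * \<bar>real_of_int (Y x)\<bar>"
        by simp
    qed
  qed (use Yint in auto)
  moreover have "expectation (\<lambda>x. cum_r n - cum_r (n - Y x) - Y x * r n) =
     expectation (\<lambda>x. cum_r n - cum_r (n - Y x)) - r n * expectation (\<lambda>x. real_of_int (Y x))" for n
    using int[of n] Yint by (subst Bochner_Integration.integral_diff) auto
  ultimately show "((\<lambda>n. expectation (\<lambda>x. cum_r n - cum_r (n - Y x)) - r n * expectation (\<lambda>x. real_of_int (Y x)))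
        \<longlongrightarrow> 0) at_top" by (simp add: tendsto_int_at_top_iff)
qed

theorem renewal_limit_finite_mean:
  assumes "integrable Q (\<lambda>x. real_of_int (X x))" "expectation (\<lambda>x. real_of_int (X x)) \<noteq> 0"
  shows "(r \<longlongrightarrow> (\<integral>z. g z \<partial>count_space UNIV) / expectation (\<lambda>x. real_of_int (X x))) at_top"
proof -
  let ?m = "expectation (\<lambda>x. real_of_int (X x))"
  have "((\<lambda>n. ((\<Sum>i. g (n - int i)) - ((\<Sum>i. g (n - int i)) - r n * ?m)) / ?m) \<longlongrightarrow> ((\<integral>z. g z \<partial>count_space UNIV) - 0) / ?m) at_top"
    using cum_r_expectation(2)[OF X assms(1)] assms(2)
    by (intro tendsto_intros backward_sums_tendsto(2)[OF g]) (simp_all add: cum_r_renewal)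
  then show ?thesis using assms(2) by simp
qed

text \<open>Replacing the step by \<open>min X K\<close> only decreases \<open>S n - S (n - X)\<close>, so in the limit \<open>r n E[min X K]\<close>
  is at most \<open>\<Sum> g\<close> for every \<open>K\<close>, while \<open>E[min X K]\<close> is unbounded.\<close>

theorem renewal_limit_infinite_mean:
  assumes inf: "\<not> integrable Q (\<lambda>x. real_of_int (X x))"
  shows "(r \<longlongrightarrow> 0) at_top"
proof (rule tendstoI)
  fix \<epsilon> :: real assume \<epsilon>: "0 < \<epsilon>"
  let ?I = "\<integral>z. g z \<partial>count_space UNIV"
  define m where "m K = expectation (\<lambda>x. real_of_int (min (X x) (int K)))" for K
  have Yint: "integrable Q (\<lambda>x. real_of_int (min (X x) (int K)))" for K
  proof (rule Bochner_Integration.integrable_bound)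
    show "integrable Q (\<lambda>x. max 0 (- real_of_int (X x)) + K)" using integrable_neg_part by simp
  qed auto
  have mono: "incseq m" unfolding m_def
    by (intro monoI integral_mono Yint) simp
  have "\<exists>K. m K > c" for c
  proof (rule ccontr)
    assume "\<not> ?thesis"
    then have bd: "\<And>K. m K \<le> c" by (simp add: not_less)
    obtain L where "m \<longlonglongrightarrow> L" using incseq_convergent[OF mono] bd by blast
    then have "integrable Q (\<lambda>x. real_of_int (X x))"
      unfolding m_def
    proof (rule integrable_monotone_convergence[OF Yint, rotated 2])
      show "AE x in Q. mono (\<lambda>K. real_of_int (min (X x) (int K)))"
        by (intro AE_I2 monoI) simp
      show "AE x in Q. (\<lambda>K. real_of_int (min (X x) (int K))) \<longlonglongrightarrow> real_of_int (X x)"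
      proof (rule AE_I2)
        fix x
        have "\<forall>\<^sub>F K in sequentially. real_of_int (min (X x) (int K)) = real_of_int (X x)"
          using eventually_ge_at_top[of "nat (X x)"] by eventually_elim auto
        then show "(\<lambda>K. real_of_int (min (X x) (int K))) \<longlonglongrightarrow> real_of_int (X x)"
          by (rule tendsto_eventually)
      qed
    qed auto
    with inf show False by simp
  qed
  then obtain K where K: "m K > (\<bar>?I\<bar> + 1) / \<epsilon>" by blast
  let ?Y = "\<lambda>x. min (X x) (int K)"
  have mpos: "0 < m K" 
  proof -
    have "0 < (\<bar>?I\<bar> + 1) / \<epsilon>" using \<epsilon> by (intro divide_pos_pos) auto
    with K show ?thesis by linarith
  qed
  have le: "expectation (\<lambda>x. cum_r n - cum_r (n - ?Y x)) \<le> (\<Sum>i. g (n - int i))" for n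
    unfolding cum_r_renewal(2)[symmetric]
  proof (rule integral_mono)
    show "integrable Q (\<lambda>x. cum_r n - cum_r (n - ?Y x))"
      by (rule cum_r_expectation(1)[OF _ Yint]) measurable
    show "integrable Q (\<lambda>x. cum_r n - cum_r (n - X x))" using cum_r_renewal(1) by simp
    show "cum_r n - cum_r (n - ?Y x) \<le> cum_r n - cum_r (n - X x)" for x
      using cum_r_mono[of "n - X x" "n - ?Y x"] by simp
  qed
  have "((\<lambda>n. (\<Sum>i. g (n - int i)) - (expectation (\<lambda>x. cum_r n - cum_r (n - ?Y x)) - r n * m K))
     \<longlongrightarrow> ?I - 0) at_top"
    unfolding m_def
    by (rule tendsto_diff[OF backward_sums_tendsto(2)[OF g] cum_r_expectation(2)[OF _ Yint]]) measurable
  then have "\<forall>\<^sub>F n in at_top. (\<Sum>i. g (n - int i)) - (expectation (\<lambda>x. cum_r n - cum_r (n - ?Y x)) - r n * m K) < \<bar>?I\<bar> + 1"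
    by (rule order_tendstoD(2)) simp
  then show "\<forall>\<^sub>F n in at_top. dist (r n) 0 < \<epsilon>"
  proof eventually_elim
    case (elim n)
    then have "r n * m K < \<bar>?I\<bar> + 1" using le[of n] by linarith
    also have "\<dots> < \<epsilon> * m K" using K \<epsilon> by (simp add: field_simps)
    finally show ?case using mpos r0[of n] by simp
  qed
qed

end
end
end

section \<open>Sums along lattices and exponential moments\<close>

lemma nn_integral_exp_substitution_le:
  fixes F :: "real \<Rightarrow> ennreal"
  assumes [measurable]: "F \<in> borel_measurable borel"
  shows "(\<integral>\<^sup>+s. ennreal (exp (a * s)) * F (exp s) \<partial>lborel)
    \<le> (\<integral>\<^sup>+t\<in>{0<..}. F t * ennreal (t powr (a - 1)) \<partial>lborel)"
proof -
  let ?f = "\<lambda>s. ennreal (exp (a * s)) * F (exp s)"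
  have sup: "?f s = (SUP n::nat. ?f s * indicator {- real (Suc n)..real (Suc n)} s)" for s
  proof -
    obtain n :: nat where "\<bar>s\<bar> \<le> real n" using real_arch_simple by blast
    then have "?f s \<le> ?f s * indicator {- real (Suc n)..real (Suc n)} s" by (auto simp: indicator_def)
    also have "\<dots> \<le> (SUP n::nat. ?f s * indicator {- real (Suc n)..real (Suc n)} s)" by (rule SUP_upper) simp
    finally show ?thesis
      by (intro antisym SUP_least) (auto simp: indicator_def)
  qed
  have "(\<integral>\<^sup>+s. ?f s \<partial>lborel) = (\<integral>\<^sup>+s. (SUP n::nat. ?f s * indicator {- real (Suc n)..real (Suc n)} s) \<partial>lborel)"
    using sup by simp
  also have "\<dots> = (SUP n::nat. (\<integral>\<^sup>+s. ?f s * indicator {- real (Suc n)..real (Suc n)} s \<partial>lborel))"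
    by (rule nn_integral_monotone_convergence_SUP) (auto simp: incseq_def le_fun_def indicator_def)
  also have "\<dots> \<le> (\<integral>\<^sup>+t\<in>{0<..}. F t * ennreal (t powr (a - 1)) \<partial>lborel)"
  proof (rule SUP_least)
    fix n :: nat
    show "(\<integral>\<^sup>+s. ?f s * indicator {- real (Suc n)..real (Suc n)} s \<partial>lborel)
      \<le> (\<integral>\<^sup>+t\<in>{0<..}. F t * ennreal (t powr (a - 1)) \<partial>lborel)"
    proof -
      have "(\<integral>\<^sup>+s. ?f s * indicator {- real (Suc n)..real (Suc n)} s \<partial>lborel)
        = (\<integral>\<^sup>+s. (F (exp s) * ennreal (exp s powr (a - 1))) * ennreal (exp s) * indicator {- real (Suc n)..real (Suc n)} s \<partial>lborel)"
      proof (intro nn_integral_cong)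
        fix s :: real
        have "exp s powr (a - 1) * exp s = exp (a * s)"
          by (simp add: powr_def algebra_simps flip: exp_add)
        then have "ennreal (exp (a * s)) = ennreal (exp s powr (a - 1)) * ennreal (exp s)"
          by (simp flip: ennreal_mult)
        then show "?f s * indicator {- real (Suc n)..real (Suc n)} s =
          (F (exp s) * ennreal (exp s powr (a - 1))) * ennreal (exp s) * indicator {- real (Suc n)..real (Suc n)} s"
          by (simp add: mult_ac)
      qed
      also have "\<dots> = (\<integral>\<^sup>+t. F t * ennreal (t powr (a - 1)) * indicator {exp (- real (Suc n))..exp (real (Suc n))} t \<partial>lborel)"
        by (rule nn_integral_substitution_aux[symmetric])
           (auto intro!: derivative_eq_intros continuous_intros)
      also have "\<dots> \<le> (\<integral>\<^sup>+t\<in>{0<..}. F t * ennreal (t powr (a - 1)) \<partial>lborel)"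
      proof (intro nn_integral_mono mult_left_mono)
        fix t :: real
        have "0 < exp (- real (Suc n))" by simp
        then show "indicator {exp (- real (Suc n))..exp (real (Suc n))} t \<le> (indicator {0<..} t :: ennreal)"
          by (auto simp: indicator_def simp del: exp_gt_zero)
      qed simp
      finally show ?thesis .
    qed
  qed
  finally show ?thesis .
qed

text \<open>The translates of the half-open cell \<open>J m\<close> by multiples of \<open>l\<close> tile the line, so the integral of the
  lattice sum over one cell equals the integral of the summand over the whole line, which is the
  given integral after \<open>t = exp s\<close>.\<close>

lemma AE_lattice_summable:
  fixes F :: "real \<Rightarrow> ennreal"
  assumes F [measurable]: "F \<in> borel_measurable borel" and l: "0 < l"
    and fin: "(\<integral>\<^sup>+t\<in>{0<..}. F t * ennreal (t powr (a - 1)) \<partial>lborel) < \<infinity>"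
  shows "AE t in lborel. (\<integral>\<^sup>+k. ennreal (exp (a * (t + real_of_int k * l))) * F (exp (t + real_of_int k * l))
           \<partial>count_space UNIV) < \<infinity>"
proof -
  define f where "f s = ennreal (exp (a * s)) * F (exp s)" for s
  have f [measurable]: "f \<in> borel_measurable borel" unfolding f_def by measurable
  define J where "J m = {real_of_int m * l ..< real_of_int m * l + l}" for m :: int
  have [measurable]: "J m \<in> sets borel" for m by (simp add: J_def)
  have Jsum: "(\<integral>\<^sup>+k. indicator (J m) (s - real_of_int k * l) \<partial>count_space UNIV) = 1" for m s
  proof -
    have "(\<integral>\<^sup>+k. indicator (J m) (s - real_of_int k * l) \<partial>count_space UNIV)
      = (\<integral>\<^sup>+k. indicator {\<lfloor>s / l\<rfloor> - m} k \<partial>count_space UNIV)"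
    proof (intro nn_integral_cong)
      fix k
      have "s - real_of_int k * l \<in> J m \<longleftrightarrow> real_of_int (k + m) \<le> s / l \<and> s / l < real_of_int (k + m) + 1"
        using l by (auto simp: J_def field_simps)
      also have "\<dots> \<longleftrightarrow> \<lfloor>s / l\<rfloor> = k + m" by (rule floor_eq_iff[symmetric])
      also have "\<dots> \<longleftrightarrow> k = \<lfloor>s / l\<rfloor> - m" by auto
      finally show "(indicator (J m) (s - real_of_int k * l) :: ennreal) = indicator {\<lfloor>s / l\<rfloor> - m} k"
        by (simp add: indicator_def)
    qed
    then show ?thesis by simp
  qed
  have [measurable]: "(\<lambda>t. \<integral>\<^sup>+k. f (t + real_of_int k * l) \<partial>count_space UNIV) \<in> borel_measurable lborel"
  proof (rule sigma_finite_measure.borel_measurable_nn_integral)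
    have [measurable]: "real_of_int \<in> borel_measurable (count_space UNIV)" by simp
    show "(\<lambda>(t, k). f (t + real_of_int k * l)) \<in> borel_measurable (lborel \<Otimes>\<^sub>M count_space UNIV)"
      by measurable
  qed (auto intro: sigma_finite_measure_count_space_countable)
  have "AE t in lborel. t \<in> J m \<longrightarrow> (\<integral>\<^sup>+k. f (t + real_of_int k * l) \<partial>count_space UNIV) < \<infinity>" for m
  proof -
    have "(\<integral>\<^sup>+t. (\<integral>\<^sup>+k. f (t + real_of_int k * l) \<partial>count_space UNIV) * indicator (J m) t \<partial>lborel)
      = (\<integral>\<^sup>+t. (\<integral>\<^sup>+k. f (t + real_of_int k * l) * indicator (J m) t \<partial>count_space UNIV) \<partial>lborel)"
      by (intro nn_integral_cong nn_integral_multc[symmetric]) auto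
    also have "\<dots> = (\<integral>\<^sup>+k. (\<integral>\<^sup>+t. f (t + real_of_int k * l) * indicator (J m) t \<partial>lborel) \<partial>count_space UNIV)"
      by (rule nn_integral_count_space_nn_integral) auto
    also have "\<dots> = (\<integral>\<^sup>+k. (\<integral>\<^sup>+s. f s * indicator (J m) (s - real_of_int k * l) \<partial>lborel) \<partial>count_space UNIV)"
    proof (rule nn_integral_cong)
      fix k
      show "(\<integral>\<^sup>+t. f (t + real_of_int k * l) * indicator (J m) t \<partial>lborel)
        = (\<integral>\<^sup>+s. f s * indicator (J m) (s - real_of_int k * l) \<partial>lborel)"
        using nn_integral_real_affine[of "\<lambda>s. f s * indicator (J m) (s - real_of_int k * l)" 1 "real_of_int k * l"]
        by (simp add: add.commute)
    qed
    also have "\<dots> = (\<integral>\<^sup>+s. (\<integral>\<^sup>+k. f s * indicator (J m) (s - real_of_int k * l) \<partial>count_space UNIV) \<partial>lborel)"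
      by (rule nn_integral_count_space_nn_integral[symmetric]) auto
    also have "\<dots> = (\<integral>\<^sup>+s. f s \<partial>lborel)"
      by (simp add: nn_integral_cmult Jsum)
    also have "\<dots> < \<infinity>"
      using nn_integral_exp_substitution_le[OF F, of a] fin unfolding f_def by (rule le_less_trans)
    finally have "AE t in lborel. (\<integral>\<^sup>+k. f (t + real_of_int k * l) \<partial>count_space UNIV) * indicator (J m) t \<noteq> \<infinity>"
      by (intro nn_integral_PInf_AE) auto
    then show ?thesis by eventually_elim (auto simp: indicator_def top.not_eq_extremum)
  qed
  then have "AE t in lborel. \<forall>m. t \<in> J m \<longrightarrow> (\<integral>\<^sup>+k. f (t + real_of_int k * l) \<partial>count_space UNIV) < \<infinity>"
    unfolding AE_all_countable by blast
  moreover have "t \<in> J \<lfloor>t / l\<rfloor>" for t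
  proof -
    have "real_of_int \<lfloor>t / l\<rfloor> * l \<le> t" using l by (simp flip: pos_le_divide_eq)
    moreover have "t / l < real_of_int \<lfloor>t / l\<rfloor> + 1" by linarith
    then have "t < real_of_int \<lfloor>t / l\<rfloor> * l + l" using l by (simp add: field_simps)
    ultimately show ?thesis by (simp add: J_def)
  qed
  ultimately show ?thesis unfolding f_def by (auto elim: eventually_mono)
qed

text \<open>The quotient \<open>(1 - exp (- \<theta> Y)) / \<theta>\<close> tends to \<open>Y\<close> as \<open>\<theta>\<close> decreases to \<open>0\<close>. If its mean were never
  positive, Fatou's lemma for the positive parts and dominated convergence for the negative parts
  would give \<open>E[Y\<^sup>+] \<le> E[Y\<^sup>-]\<close>. Fatou's lemma is what admits an infinite mean.\<close>

lemma (in prob_space) exists_contracting_exponent: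
  fixes Y :: "'a \<Rightarrow> real"
  assumes Y [measurable]: "Y \<in> borel_measurable M" and \<theta>0: "0 < \<theta>0"
    and int: "integrable M (\<lambda>x. exp (- \<theta>0 * Y x))"
    and drift: "(\<integral>\<^sup>+x. ennreal (- Y x) \<partial>M) < (\<integral>\<^sup>+x. ennreal (Y x) \<partial>M)"
  obtains \<theta> where "0 < \<theta>" "\<theta> < \<theta>0" "integrable M (\<lambda>x. exp (- \<theta> * Y x))"
    "expectation (\<lambda>x. exp (- \<theta> * Y x)) < 1"
proof -
  \<comment> \<open>The offset keeps \<open>t i \<le> \<theta>0 / 2\<close>, which leaves room to absorb the factor \<open>y\<close> below.\<close>
  define t where "t i = \<theta>0 / (real i + 2)" for i :: nat
  have t: "0 < t i" "t i < \<theta>0" "t i \<le> \<theta>0 / 2" for i using \<theta>0 by (auto simp: t_def field_simps intro: add_pos_nonneg)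
  have t0: "t \<longlonglongrightarrow> 0"
    unfolding t_def by real_asymp
  have bound: "exp (- \<theta> * y) \<le> 1 + exp (- \<theta>0 * y)" if "0 < \<theta>" "\<theta> < \<theta>0" for \<theta> y :: real
  proof (cases "0 \<le> y")
    case True then have "exp (- \<theta> * y) \<le> 1" using that by simp
    then show ?thesis using exp_gt_zero[of "- \<theta>0 * y"] by linarith
  next
    case False
    then have "exp (- \<theta> * y) \<le> exp (- \<theta>0 * y)" using that by simp
    then show ?thesis by linarith
  qed
  have inte: "integrable M (\<lambda>x. exp (- \<theta> * Y x))" if "0 < \<theta>" "\<theta> < \<theta>0" for \<theta>
    by (rule Bochner_Integration.integrable_bound[of _ "\<lambda>x. 1 + exp (- \<theta>0 * Y x)"])
       (use int bound[OF that] in \<open>auto simp: abs_of_pos add_pos_pos\<close>)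
  define f where "f i x = (1 - exp (- t i * Y x)) / t i" for i x
  have fint: "integrable M (f i)" for i unfolding f_def using inte[OF t(1,2)] by simp
  have f [measurable]: "f i \<in> borel_measurable M" for i unfolding f_def by measurable
  have "\<exists>i. expectation (\<lambda>x. exp (- t i * Y x)) < 1"
  proof (rule ccontr)
    assume "\<not> ?thesis"
    then have *: "expectation (\<lambda>x. exp (- t i * Y x)) \<ge> 1" for i by (simp add: not_less)
    have le: "(\<integral>\<^sup>+x. ennreal (f i x) \<partial>M) \<le> (\<integral>\<^sup>+x. ennreal (- f i x) \<partial>M)" for i
    proof -
      have "expectation (f i) = (1 - expectation (\<lambda>x. exp (- t i * Y x))) / t i"
        unfolding f_def using inte[OF t(1,2), of i] by (simp add: prob_space)
      also have "\<dots> \<le> 0" using *[of i] t(1)[of i] by (simp add: divide_le_0_iff)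
      finally have "expectation (f i) \<le> 0" .
      then have "enn2real (\<integral>\<^sup>+x. ennreal (f i x) \<partial>M) \<le> enn2real (\<integral>\<^sup>+x. ennreal (- f i x) \<partial>M)"
        by (simp add: real_lebesgue_integral_def[OF fint])
      moreover have "(\<integral>\<^sup>+x. ennreal (f i x) \<partial>M) \<noteq> \<infinity>" "(\<integral>\<^sup>+x. ennreal (- f i x) \<partial>M) \<noteq> \<infinity>"
        using fint[of i] by (auto simp: real_integrable_def)
      ultimately show ?thesis by (metis enn2real_nonneg ennreal_enn2real_if ennreal_leI infinity_ennreal_def)
    qed
    have fY: "(\<lambda>i. f i x) \<longlonglongrightarrow> Y x" for x
    proof -
      have "((\<lambda>\<theta>. (1 - exp (- \<theta> * y)) / \<theta>) \<longlongrightarrow> y) (at_right 0)" for y :: real by real_asymp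
      moreover have "filterlim t (at_right 0) sequentially"
        using t0 t(1) by (auto simp: filterlim_at_right_to_0 intro!: tendsto_imp_filterlim_at_right)
      ultimately show ?thesis unfolding f_def by (rule filterlim_compose)
    qed
    have "(\<integral>\<^sup>+x. ennreal (Y x) \<partial>M) = (\<integral>\<^sup>+x. liminf (\<lambda>i. ennreal (f i x)) \<partial>M)"
      using fY by (intro nn_integral_cong lim_imp_Liminf[symmetric] tendsto_ennrealI) auto
    also have "\<dots> \<le> liminf (\<lambda>i. \<integral>\<^sup>+x. ennreal (f i x) \<partial>M)"
      by (rule nn_integral_liminf) measurable
    also have "\<dots> \<le> liminf (\<lambda>i. \<integral>\<^sup>+x. ennreal (- f i x) \<partial>M)"
      by (intro Liminf_mono always_eventually allI le)
    also have "\<dots> = (\<integral>\<^sup>+x. ennreal (- Y x) \<partial>M)"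
    proof (intro lim_imp_Liminf)
      show "(\<lambda>i. \<integral>\<^sup>+x. ennreal (- f i x) \<partial>M) \<longlonglongrightarrow> (\<integral>\<^sup>+x. ennreal (- Y x) \<partial>M)"
      proof (rule nn_integral_dominated_convergence[where w = "\<lambda>x. ennreal (2 / \<theta>0 * exp (- \<theta>0 * Y x))"])
        have "integrable M (\<lambda>x. 2 / \<theta>0 * exp (- \<theta>0 * Y x))" using int by simp
        then show "(\<integral>\<^sup>+x. ennreal (2 / \<theta>0 * exp (- \<theta>0 * Y x)) \<partial>M) < \<infinity>"
          by (simp add: real_integrable_def top.not_eq_extremum)
        show "AE x in M. (\<lambda>i. ennreal (- f i x)) \<longlonglongrightarrow> ennreal (- Y x)"
          using fY by (intro AE_I2 tendsto_ennrealI tendsto_minus)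
        show "AE x in M. ennreal (- f i x) \<le> ennreal (2 / \<theta>0 * exp (- \<theta>0 * Y x))" for i
        proof (intro AE_I2 ennreal_leI)
          fix x
          show "- f i x \<le> 2 / \<theta>0 * exp (- \<theta>0 * Y x)"
          proof (cases "0 \<le> Y x")
            case True
            then have "- f i x \<le> 0" using t(1)[of i] by (simp add: f_def divide_le_0_iff)
            also have "0 \<le> 2 / \<theta>0 * exp (- \<theta>0 * Y x)" using \<theta>0 by simp
            finally show ?thesis .
          next
            case False
            define y where "y = - Y x"
            have y: "0 < y" using False by (simp add: y_def)
            have "1 - t i * y \<le> exp (- (t i * y))" using exp_ge_add_one_self[of "- (t i * y)"] by simp
            then have "(1 - t i * y) * exp (t i * y) \<le> exp (- (t i * y)) * exp (t i * y)"
              by (intro mult_right_mono) auto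
            then have "exp (t i * y) - 1 \<le> t i * y * exp (t i * y)"
              by (simp add: algebra_simps flip: exp_add)
            then have "- f i x \<le> y * exp (t i * y)"
              using t(1)[of i] by (simp add: f_def y_def field_simps)
            also have "\<dots> \<le> (2 / \<theta>0 * exp (\<theta>0 / 2 * y)) * exp (\<theta>0 / 2 * y)"
            proof (intro mult_mono)
              have "\<theta>0 / 2 * y \<le> exp (\<theta>0 / 2 * y)" using exp_ge_add_one_self[of "\<theta>0 / 2 * y"] by linarith
              then show "y \<le> 2 / \<theta>0 * exp (\<theta>0 / 2 * y)" using \<theta>0 by (simp add: field_simps)
              show "exp (t i * y) \<le> exp (\<theta>0 / 2 * y)" using t(3)[of i] y by simp
            qed (use \<theta>0 in auto)
            also have "\<dots> = 2 / \<theta>0 * exp (- \<theta>0 * Y x)"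
              by (simp add: y_def mult.assoc flip: exp_add)
            finally show ?thesis .
          qed
        qed
      qed measurable
    qed simp
    finally show False using drift by simp
  qed
  then obtain i where "expectation (\<lambda>x. exp (- t i * Y x)) < 1" ..
  then show thesis by (intro that[of "t i"] inte t)
qed

section \<open>The weights under the tilted measure\<close>

lemma borel_countable_set: "countable A \<Longrightarrow> A \<in> sets (borel :: real measure)"
  by (rule sets.countable) auto

lemma countable_lattice: "countable (lattice l)"
proof -
  have "lattice l = range (\<lambda>k::int. l * of_int k)" by (auto simp: lattice_def)
  then show ?thesis by simp
qed

lemma ereal_diff_of_add_eq:
  fixes a b p m :: ennreal
  assumes "a + m = p + b" "m < \<infinity>" "b < \<infinity>"
  shows "enn2ereal a - enn2ereal b = enn2ereal p - enn2ereal m"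
proof -
  have "enn2ereal a + enn2ereal m = enn2ereal p + enn2ereal b"
    using assms(1) by (metis plus_ennreal.rep_eq)
  moreover have "\<bar>enn2ereal m\<bar> \<noteq> \<infinity>" "\<bar>enn2ereal b\<bar> \<noteq> \<infinity>"
    using assms(2,3) by (auto simp: less_top[symmetric] enn2ereal_eq_top_iff)
  ultimately show ?thesis
    by (cases "enn2ereal a"; cases "enn2ereal b"; cases "enn2ereal p"; cases "enn2ereal m") auto
qed

locale weighted_branching = prob_space M for M :: "'a measure" +
  fixes N :: "'a \<Rightarrow> enat" and C :: "nat \<Rightarrow> 'a \<Rightarrow> real" and R :: "'a \<Rightarrow> real" and \<alpha> \<gamma> l :: real
  assumes weights_measurable: "weight_vector N C \<in> M \<rightarrow>\<^sub>M vector_algebra"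
    and R_measurable [measurable]: "R \<in> borel_measurable M"
    and independent: "indep_of_weights M N C R"
    and \<alpha>_pos: "\<alpha> > 0"
    and span: "lattice_span M N C l"
    and moment_one: "weight_moment M N C \<alpha> = 1"
    and \<gamma>_nonneg: "0 \<le> \<gamma>"
    and \<gamma>_less: "\<gamma> < \<alpha>"
    and moment_finite: "weight_moment M N C \<gamma> < \<infinity>"
begin

lemma l_pos: "0 < l" using span by (simp add: lattice_span_def)

text \<open>The padded weights. Unlike \<open>C j\<close> they are measurable on the whole space, and the zeros do not
  contribute to any of the sums in question.\<close>

definition c :: "nat \<Rightarrow> 'a \<Rightarrow> real" where
  "c j \<omega> = (if j \<in> present (N \<omega>) then C j \<omega> else 0)"

lemma c_weight_vector: "1 \<le> j \<Longrightarrow> c j \<omega> = snd (weight_vector N C \<omega>) j"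
  by (simp add: c_def weight_vector_def)

lemma c_0: "c 0 = (\<lambda>_. 0)"
  by (auto simp: c_def present_def)

lemma coordinate_measurable: "1 \<le> j \<Longrightarrow> (\<lambda>p. snd p j) \<in> borel_measurable vector_algebra"
  unfolding vector_algebra_def by measurable

lemma c_measurable [measurable]: "c j \<in> borel_measurable M"
proof (cases "j = 0")
  case True then show ?thesis by (simp add: c_0)
next
  case False
  then have "(\<lambda>\<omega>. snd (weight_vector N C \<omega>) j) \<in> borel_measurable M"
    by (intro measurable_compose[OF weights_measurable coordinate_measurable]) auto
  then show ?thesis using False by (simp add: c_weight_vector cong: measurable_cong)
qed

lemma infsum_present:
  fixes f :: "real \<Rightarrow> ennreal"
  assumes "f 0 = 0"
  shows "(\<Sum>\<^sub>\<infinity>j\<in>present (N \<omega>). f (C j \<omega>)) = (\<integral>\<^sup>+j. f (c j \<omega>) \<partial>count_space UNIV)"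
proof -
  have "(\<Sum>\<^sub>\<infinity>j\<in>present (N \<omega>). f (C j \<omega>)) = (\<Sum>\<^sub>\<infinity>j. f (c j \<omega>))"
    by (rule infsum_cong_neutral) (use assms in \<open>auto simp: c_def\<close>)
  also have "\<dots> = (\<Sum>j. f (c j \<omega>))"
    by (rule sums_unique[OF has_sum_imp_sums[OF has_sum_infsum]]) (auto intro: nonneg_summable_on_complete)
  finally show ?thesis by (simp add: nn_integral_count_space_nat)
qed

lemma weight_moment_eq:
  "weight_moment M N C b = (\<integral>\<^sup>+\<omega>. (\<integral>\<^sup>+j. ennreal (\<bar>c j \<omega>\<bar> powr b) \<partial>count_space UNIV) \<partial>M)"
  unfolding weight_moment_def by (intro nn_integral_cong infsum_present[of "\<lambda>x. ennreal (\<bar>x\<bar> powr b)"]) simp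

abbreviation pairs :: "(nat \<times> 'a) measure" where "pairs \<equiv> count_space UNIV \<Otimes>\<^sub>M M"

lemma pair_sf: "pair_sigma_finite (count_space UNIV :: nat measure) M"
  by (intro pair_sigma_finite.intro sigma_finite_measure_count_space_countable sigma_finite_measure_axioms) auto

lemma c_pair_measurable [measurable]: "(\<lambda>z. c (fst z) (snd z)) \<in> borel_measurable pairs"
  by (rule measurable_pair_measure_countable1) auto

text \<open>The change of measure that makes the weighted sums over \<open>j\<close> expectations. Its second marginal is
  a size-biased law, and zero weights are never selected.\<close>

definition tilted :: "(nat \<times> 'a) measure" where
  "tilted = density pairs (\<lambda>z. ennreal (\<bar>c (fst z) (snd z)\<bar> powr \<alpha>))"

abbreviation w :: "nat \<times> 'a \<Rightarrow> real" where "w z \<equiv> c (fst z) (snd z)"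

lemma sets_tilted [measurable_cong, simp]: "sets tilted = sets pairs"
  by (simp add: tilted_def)

lemma nn_integral_tilted:
  assumes [measurable]: "f \<in> borel_measurable pairs"
  shows "(\<integral>\<^sup>+z. f z \<partial>tilted) = (\<integral>\<^sup>+\<omega>. (\<integral>\<^sup>+j. ennreal (\<bar>c j \<omega>\<bar> powr \<alpha>) * f (j, \<omega>) \<partial>count_space UNIV) \<partial>M)"
proof -
  have "(\<integral>\<^sup>+z. f z \<partial>tilted) = (\<integral>\<^sup>+z. ennreal (\<bar>w z\<bar> powr \<alpha>) * f z \<partial>pairs)"
    unfolding tilted_def by (rule nn_integral_density) measurable
  also have "\<dots> = (\<integral>\<^sup>+\<omega>. (\<integral>\<^sup>+j. ennreal (\<bar>w (j, \<omega>)\<bar> powr \<alpha>) * f (j, \<omega>) \<partial>count_space UNIV) \<partial>M)"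
    by (rule pair_sigma_finite.nn_integral_snd[OF pair_sf, symmetric]) measurable
  finally show ?thesis by simp
qed

lemma prob_space_tilted: "prob_space tilted"
proof
  have "emeasure tilted (space tilted) = (\<integral>\<^sup>+z. 1 \<partial>tilted)" by simp
  also have "\<dots> = 1" using moment_one by (subst nn_integral_tilted) (auto simp: weight_moment_eq)
  finally show "emeasure tilted (space tilted) = 1" .
qed

lemma AE_tilted_iff:
  assumes [measurable]: "S \<in> sets borel"
  shows "(AE z in tilted. w z \<in> S) \<longleftrightarrow> nonzero_weights_in M N C S"
proof -
  have "(AE z in tilted. w z \<in> S) \<longleftrightarrow> (AE z in pairs. w z \<noteq> 0 \<longrightarrow> w z \<in> S)"
    unfolding tilted_def using \<alpha>_pos by (subst AE_density) (auto simp: powr_gt_zero)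
  also have "\<dots> \<longleftrightarrow> (\<forall>j. AE \<omega> in M. c j \<omega> \<noteq> 0 \<longrightarrow> c j \<omega> \<in> S)"
  proof
    assume "AE z in pairs. w z \<noteq> 0 \<longrightarrow> w z \<in> S"
    from pair_sigma_finite.AE_pair[OF pair_sf this]
    show "\<forall>j. AE \<omega> in M. c j \<omega> \<noteq> 0 \<longrightarrow> c j \<omega> \<in> S" by (simp add: AE_count_space)
  next
    assume "\<forall>j. AE \<omega> in M. c j \<omega> \<noteq> 0 \<longrightarrow> c j \<omega> \<in> S"
    then show "AE z in pairs. w z \<noteq> 0 \<longrightarrow> w z \<in> S"
      by (intro pair_sigma_finite.AE_pair_measure[OF pair_sf]) (auto simp: AE_count_space)
  qed
  also have "\<dots> \<longleftrightarrow> nonzero_weights_in M N C S"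
    unfolding nonzero_weights_in_def by (intro all_cong1 AE_cong) (auto simp: c_def)
  finally show ?thesis .
qed

text \<open>The quotient is an integer already, except on a null set and for vanishing weights.\<close>

definition X :: "nat \<times> 'a \<Rightarrow> int" where "X z = round (ln \<bar>w z\<bar> / l)"
definition e :: "nat \<times> 'a \<Rightarrow> real" where "e z = (if w z < 0 then -1 else 1)"

lemma X_measurable [measurable]: "X \<in> tilted \<rightarrow>\<^sub>M count_space UNIV"
  unfolding X_def round_def by measurable

lemma e_measurable [measurable]: "e \<in> borel_measurable tilted"
  unfolding e_def by measurable

lemma abs_e: "\<bar>e z\<bar> = 1" by (simp add: e_def)

lemma lattice_borel: "{x. ln \<bar>x\<bar> \<in> lattice l'} \<in> sets (borel :: real measure)"
proof -
  have [measurable]: "lattice l' \<in> sets borel" by (rule borel_countable_set[OF countable_lattice])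
  have "(\<lambda>x::real. ln \<bar>x\<bar>) -` lattice l' \<inter> space borel \<in> sets borel" by measurable
  then show ?thesis by (simp add: vimage_def)
qed

lemma AE_w_nonzero: "AE z in tilted. w z \<noteq> 0"
proof -
  have "(AE z in tilted. w z \<in> - {0})"
    by (subst AE_tilted_iff) (auto simp: nonzero_weights_in_def)
  then show ?thesis by simp
qed

lemma AE_w: "AE z in tilted. ln \<bar>w z\<bar> = l * X z \<and> w z = e z * exp (l * X z)"
proof -
  have "AE z in tilted. w z \<in> {x. ln \<bar>x\<bar> \<in> lattice l}"
    using span by (subst AE_tilted_iff[OF lattice_borel]) (simp add: lattice_span_def log_weights_in_def)
  with AE_w_nonzero show ?thesis
  proof eventually_elim
    case (elim z)
    then obtain k where k: "ln \<bar>w z\<bar> = l * real_of_int k" by (auto simp: lattice_def)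
    then have "ln \<bar>w z\<bar> = l * X z" using l_pos by (simp add: X_def)
    moreover from this have "\<bar>w z\<bar> = exp (l * X z)" using elim by (metis zero_less_abs_iff exp_ln)
    ultimately show ?case by (auto simp: e_def abs_if split: if_splits)
  qed
qed

lemma AE_ln_w: "AE z in tilted. ln \<bar>w z\<bar> = l * X z"
  using AE_w by (rule eventually_mono) blast

text \<open>Were all values of \<open>X\<close> multiples of \<open>d\<close>, the logarithms would live on the coarser lattice of span
  \<open>\<bar>d\<bar> l\<close>, or on every lattice if \<open>d = 0\<close>.\<close>

lemma X_span:
  assumes "AE z in tilted. d dvd X z"
  shows "d dvd 1"
proof (rule ccontr)
  assume nd: "\<not> d dvd 1"
  \<comment> \<open>For \<open>d = 0\<close> any span larger than \<open>l\<close> would do.\<close>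
  define l' where "l' = (if d = 0 then 2 * l else \<bar>real_of_int d\<bar> * l)"
  have "\<bar>d\<bar> \<ge> 2 \<or> d = 0" using nd by (cases "\<bar>d\<bar> = 1") (auto simp: zdvd1_eq)
  then have "\<bar>real_of_int d\<bar> \<ge> 2 \<or> d = 0" by linarith
  then have "l < l'" using l_pos by (auto simp: l'_def)
  have "AE z in tilted. w z \<in> {x. ln \<bar>x\<bar> \<in> lattice l'}"
    using AE_w assms
  proof eventually_elim
    case (elim z)
    then obtain k where k: "X z = d * k" by (auto simp: dvd_def)
    have "\<exists>m::int. l * X z = l' * m"
    proof (cases "d = 0")
      case True then show ?thesis using k by (intro exI[of _ 0]) simp
    next
      case False then show ?thesis using k
        by (intro exI[of _ "sgn d * k"]) (auto simp: l'_def sgn_if)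
    qed
    with elim show ?case by (auto simp: lattice_def)
  qed
  then have "log_weights_in M N C l'"
    by (subst (asm) AE_tilted_iff[OF lattice_borel]) (simp add: log_weights_in_def)
  with span \<open>l < l'\<close> show False by (auto simp: lattice_span_def)
qed

lemma exp_moment: "integrable tilted (\<lambda>z. exp (- ((\<alpha> - \<gamma>) * l) * X z))"
proof -
  have "(\<integral>\<^sup>+z. ennreal (exp (- ((\<alpha> - \<gamma>) * l) * X z)) \<partial>tilted) = (\<integral>\<^sup>+z. ennreal (\<bar>w z\<bar> powr (\<gamma> - \<alpha>)) \<partial>tilted)"
  proof (rule nn_integral_cong_AE)
    show "AE z in tilted. ennreal (exp (- ((\<alpha> - \<gamma>) * l) * X z)) = ennreal (\<bar>w z\<bar> powr (\<gamma> - \<alpha>))"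
      using AE_w_nonzero AE_ln_w by eventually_elim (simp add: powr_def algebra_simps)
  qed
  also have "\<dots> = (\<integral>\<^sup>+\<omega>. (\<integral>\<^sup>+j. ennreal (\<bar>c j \<omega>\<bar> powr \<alpha>) * ennreal (\<bar>c j \<omega>\<bar> powr (\<gamma> - \<alpha>)) \<partial>count_space UNIV) \<partial>M)"
    by (subst nn_integral_tilted) auto
  also have "\<dots> = weight_moment M N C \<gamma>"
    unfolding weight_moment_eq
    by (intro nn_integral_cong) (auto simp: powr_add[symmetric] simp flip: ennreal_mult)
  finally show ?thesis using moment_finite by (intro integrableI_nonneg) auto
qed

text \<open>The drift is defined by the two parts of the sum over \<open>j\<close>, the mean of \<open>l X\<close> by the sums of the two
  parts of each summand. The difference of the two sums is almost surely the same real number: only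
  finitely many weights exceed \<open>1\<close> in modulus, because \<open>\<Sum>\<bar>C\<^sub>j\<bar>\<^sup>\<alpha>\<close> converges. As the negative parts
  are integrable by the moment of order \<open>\<gamma>\<close>, the differences of the expectations agree, too.\<close>

lemma drift_eq:
  "weight_drift M N C \<alpha> =
     enn2ereal (\<integral>\<^sup>+z. ennreal (l * X z) \<partial>tilted) - enn2ereal (\<integral>\<^sup>+z. ennreal (- (l * X z)) \<partial>tilted)" (is ?A)
  "(\<integral>\<^sup>+z. ennreal (- (l * X z)) \<partial>tilted) < \<infinity>" (is ?B)
proof -
  interpret Q: prob_space tilted by (rule prob_space_tilted)
  define f where "f \<omega> j = \<bar>c j \<omega>\<bar> powr \<alpha> * ln \<bar>c j \<omega>\<bar>" for \<omega> j
  define vp vm where "vp \<omega> = (\<integral>\<^sup>+j. ennreal (f \<omega> j) \<partial>count_space UNIV)"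
    and "vm \<omega> = (\<integral>\<^sup>+j. ennreal (- f \<omega> j) \<partial>count_space UNIV)" for \<omega>
  have f [measurable]: "(\<lambda>\<omega>. f \<omega> j) \<in> borel_measurable M" for j unfolding f_def by measurable
  have [measurable]: "vp \<in> borel_measurable M" "vm \<in> borel_measurable M"
    unfolding vp_def vm_def nn_integral_count_space_nat by measurable
  have vp: "(\<integral>\<^sup>+z. ennreal (l * X z) \<partial>tilted) = (\<integral>\<^sup>+\<omega>. vp \<omega> \<partial>M)"
  proof -
    have "(\<integral>\<^sup>+z. ennreal (l * X z) \<partial>tilted) = (\<integral>\<^sup>+z. ennreal (ln \<bar>w z\<bar>) \<partial>tilted)"
      by (rule nn_integral_cong_AE) (use AE_ln_w in \<open>eventually_elim, simp\<close>)
    also have "\<dots> = (\<integral>\<^sup>+\<omega>. vp \<omega> \<partial>M)"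
      by (subst nn_integral_tilted) (auto simp: vp_def f_def ennreal_mult' intro!: nn_integral_cong)
    finally show ?thesis .
  qed
  have vm: "(\<integral>\<^sup>+z. ennreal (- (l * X z)) \<partial>tilted) = (\<integral>\<^sup>+\<omega>. vm \<omega> \<partial>M)"
  proof -
    have "(\<integral>\<^sup>+z. ennreal (- (l * X z)) \<partial>tilted) = (\<integral>\<^sup>+z. ennreal (- ln \<bar>w z\<bar>) \<partial>tilted)"
      by (rule nn_integral_cong_AE) (use AE_ln_w in \<open>eventually_elim, simp\<close>)
    also have "\<dots> = (\<integral>\<^sup>+\<omega>. vm \<omega> \<partial>M)"
      by (subst nn_integral_tilted) (auto simp: vm_def f_def ennreal_mult'[symmetric] intro!: nn_integral_cong)
    finally show ?thesis .
  qed
  have "(\<integral>\<^sup>+z. ennreal (- (l * X z)) \<partial>tilted)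
      \<le> (\<integral>\<^sup>+z. ennreal (1 / (\<alpha> - \<gamma>)) * ennreal (exp (- ((\<alpha> - \<gamma>) * l) * X z)) \<partial>tilted)"
  proof (intro nn_integral_mono)
    fix z
    have "(\<alpha> - \<gamma>) * (- (l * X z)) \<le> exp (- ((\<alpha> - \<gamma>) * l) * X z)"
      using exp_ge_add_one_self[of "- ((\<alpha> - \<gamma>) * l) * X z"] by (simp add: algebra_simps)
    then have "- (l * X z) \<le> 1 / (\<alpha> - \<gamma>) * exp (- ((\<alpha> - \<gamma>) * l) * X z)"
      using \<gamma>_less by (simp add: field_simps)
    then show "ennreal (- (l * X z)) \<le> ennreal (1 / (\<alpha> - \<gamma>)) * ennreal (exp (- ((\<alpha> - \<gamma>) * l) * X z))"
      using \<gamma>_less by (subst ennreal_mult[symmetric]) (auto intro: ennreal_leI)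
  qed
  also have "\<dots> < \<infinity>"
    using exp_moment by (subst nn_integral_cmult) (auto simp: real_integrable_def ennreal_mult_less_top top.not_eq_extremum)
  finally show B: ?B .
  then have vmfin: "(\<integral>\<^sup>+\<omega>. vm \<omega> \<partial>M) < \<infinity>" by (simp add: vm)
  have AEvm: "AE \<omega> in M. vm \<omega> \<noteq> \<infinity>" using vmfin by (intro nn_integral_PInf_AE) auto
  have AEmom: "AE \<omega> in M. (\<integral>\<^sup>+j. ennreal (\<bar>c j \<omega>\<bar> powr \<alpha>) \<partial>count_space UNIV) \<noteq> \<infinity>"
    using moment_one unfolding weight_moment_eq nn_integral_count_space_nat
    by (intro nn_integral_PInf_AE) auto
  have AEY: "AE \<omega> in M. vp \<omega> \<noteq> \<infinity> \<and> vm \<omega> \<noteq> \<infinity> \<and>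
      (\<Sum>\<^sub>\<infinity>j\<in>present (N \<omega>). \<bar>C j \<omega>\<bar> powr \<alpha> * ln \<bar>C j \<omega>\<bar>) = enn2real (vp \<omega>) - enn2real (vm \<omega>)"
    using AEvm AEmom
  proof eventually_elim
    case (elim \<omega>)
    have "summable (\<lambda>j. \<bar>c j \<omega>\<bar> powr \<alpha>)"
      using elim(2) by (intro summable_suminf_not_top) (auto simp: nn_integral_count_space_nat)
    then have "\<forall>\<^sub>F j in sequentially. \<bar>c j \<omega>\<bar> powr \<alpha> < 1"
      using order_tendstoD(2)[OF summable_LIMSEQ_zero] zero_less_one by blast
    then obtain J where J: "\<bar>c j \<omega>\<bar> powr \<alpha> < 1" if "j \<ge> J" for j by (auto simp: eventually_sequentially)
    have "ennreal (f \<omega> j) = 0" if "j \<notin> {..<J}" for j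
    proof (cases "c j \<omega> = 0")
      case False
      have "\<bar>c j \<omega>\<bar> < 1"
        using J[of j] that \<alpha>_pos by (metis abs_ge_zero lessThan_iff not_less powr_one_eq_one powr_mono2 less_le zero_le_one)
      then have "ln \<bar>c j \<omega>\<bar> \<le> 0" using False by simp
      then show ?thesis unfolding f_def by (intro ennreal_neg mult_nonneg_nonpos) auto
    qed (simp add: f_def)
    then have "vp \<omega> = (\<Sum>j<J. ennreal (f \<omega> j))"
      unfolding vp_def by (intro nn_integral_count_space') auto
    then have vpfin: "vp \<omega> \<noteq> \<infinity>" by simp
    have int: "integrable (count_space UNIV) (f \<omega>)"
      using vpfin elim(1) by (simp add: real_integrable_def vp_def vm_def)
    have "(\<Sum>\<^sub>\<infinity>j\<in>present (N \<omega>). \<bar>C j \<omega>\<bar> powr \<alpha> * ln \<bar>C j \<omega>\<bar>) = infsum (f \<omega>) UNIV"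
      by (rule infsum_cong_neutral) (auto simp: f_def c_def)
    also have "\<dots> = infsetsum (f \<omega>) UNIV"
      using int by (intro infsetsum_infsum[symmetric]) (simp add: Infinite_Set_Sum.abs_summable_on_def)
    also have "\<dots> = enn2real (vp \<omega>) - enn2real (vm \<omega>)"
      by (simp add: infsetsum_def real_lebesgue_integral_def[OF int] vp_def vm_def)
    finally show ?case using vpfin elim(1) by simp
  qed
  define Y where "Y \<omega> = enn2real (vp \<omega>) - enn2real (vm \<omega>)" for \<omega>
  have [measurable]: "Y \<in> borel_measurable M" unfolding Y_def by measurable
  have ext: "weight_drift M N C \<alpha> = enn2ereal (\<integral>\<^sup>+\<omega>. ennreal (Y \<omega>) \<partial>M) - enn2ereal (\<integral>\<^sup>+\<omega>. ennreal (- Y \<omega>) \<partial>M)"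
  proof -
    have "(\<integral>\<^sup>+\<omega>. ennreal (\<Sum>\<^sub>\<infinity>j\<in>present (N \<omega>). \<bar>C j \<omega>\<bar> powr \<alpha> * ln \<bar>C j \<omega>\<bar>) \<partial>M) = (\<integral>\<^sup>+\<omega>. ennreal (Y \<omega>) \<partial>M)"
      by (rule nn_integral_cong_AE) (use AEY in \<open>eventually_elim, simp add: Y_def\<close>)
    moreover have "(\<integral>\<^sup>+\<omega>. ennreal (- (\<Sum>\<^sub>\<infinity>j\<in>present (N \<omega>). \<bar>C j \<omega>\<bar> powr \<alpha> * ln \<bar>C j \<omega>\<bar>)) \<partial>M) = (\<integral>\<^sup>+\<omega>. ennreal (- Y \<omega>) \<partial>M)"
      by (rule nn_integral_cong_AE) (use AEY in \<open>eventually_elim, simp add: Y_def\<close>)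
    ultimately show ?thesis by (simp add: weight_drift_def ext_expectation_def)
  qed
  have Yle: "(\<integral>\<^sup>+\<omega>. ennreal (- Y \<omega>) \<partial>M) \<le> (\<integral>\<^sup>+\<omega>. vm \<omega> \<partial>M)"
  proof (rule nn_integral_mono_AE)
    show "AE \<omega> in M. ennreal (- Y \<omega>) \<le> vm \<omega>" using AEvm
    proof eventually_elim
      case (elim \<omega>)
      have "ennreal (- Y \<omega>) \<le> ennreal (enn2real (vm \<omega>))" unfolding Y_def by (intro ennreal_leI) simp
      then show ?case using elim by (simp add: ennreal_enn2real_if)
    qed
  qed
  have "(\<integral>\<^sup>+\<omega>. ennreal (Y \<omega>) \<partial>M) + (\<integral>\<^sup>+\<omega>. vm \<omega> \<partial>M) = (\<integral>\<^sup>+\<omega>. vp \<omega> \<partial>M) + (\<integral>\<^sup>+\<omega>. ennreal (- Y \<omega>) \<partial>M)"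
  proof -
    have "AE \<omega> in M. ennreal (Y \<omega>) + vm \<omega> = vp \<omega> + ennreal (- Y \<omega>)" using AEY
    proof eventually_elim
      case (elim \<omega>)
      obtain p m where pm: "vp \<omega> = ennreal p" "0 \<le> p" "vm \<omega> = ennreal m" "0 \<le> m"
        using elim by (cases "vp \<omega>"; cases "vm \<omega>") auto
      show ?case
      proof (cases "m \<le> p")
        case True then show ?thesis using pm
          by (simp add: Y_def ennreal_neg flip: ennreal_plus)
      next
        case False then show ?thesis using pm
          by (simp add: Y_def ennreal_neg flip: ennreal_plus)
      qed
    qed
    then show ?thesis
      by (subst (1 2) nn_integral_add[symmetric]) (auto intro: nn_integral_cong_AE)
  qed
  from ereal_diff_of_add_eq[OF this vmfin le_less_trans[OF Yle vmfin]]
  show ?A unfolding ext vp vm .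
qed

end

section \<open>The renewal equation for the tails\<close>

text \<open>One family for both tails, in which a weight of sign \<open>e\<close> turns the tail \<open>s e\<close> of \<open>R\<close> into the tail
  \<open>s\<close> of the product.\<close>

definition sgn_tail :: "real \<Rightarrow> real \<Rightarrow> real set" where "sgn_tail s u = {x. s * x > u}"

lemma right_tail_eq: "right_tail = sgn_tail 1" by (simp add: right_tail_def sgn_tail_def fun_eq_iff)
lemma left_tail_eq: "left_tail = sgn_tail (-1)" by (auto simp: left_tail_def sgn_tail_def fun_eq_iff)

context weighted_branching begin

definition tailP :: "real \<Rightarrow> real \<Rightarrow> real" where
  "tailP s u = prob {\<omega> \<in> space M. s * R \<omega> > u}"

text \<open>For \<open>j \<ge> 1\<close> the padded weight is a coordinate of the random vector, so its events belong to the
  sigma-algebra that is independent of \<open>R\<close>; for \<open>j = 0\<close> it is constant.\<close>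

lemma weight_indep: "indep_var borel (c j) borel R"
  unfolding indep_var_eq
proof (intro conjI c_measurable R_measurable indep_setI)
  have sig: "sigma_sets (space M) {Y -` A \<inter> space M | A. A \<in> sets borel} = {Y -` A \<inter> space M | A. A \<in> sets borel}"
    for Y :: "'a \<Rightarrow> real"
    using sets.sigma_sets_eq[of "vimage_algebra (space M) Y borel"]
    by (simp add: sets_vimage_algebra2)
  show "sigma_sets (space M) {c j -` A \<inter> space M | A. A \<in> sets borel} \<subseteq> events"
    "sigma_sets (space M) {R -` A \<inter> space M | A. A \<in> sets borel} \<subseteq> events"
    unfolding sig by auto
  fix a b assume "a \<in> sigma_sets (space M) {c j -` A \<inter> space M | A. A \<in> sets borel}"
    "b \<in> sigma_sets (space M) {R -` A \<inter> space M | A. A \<in> sets borel}"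
  then obtain A B where A: "A \<in> sets borel" "a = c j -` A \<inter> space M"
    and B: "B \<in> sets borel" "b = R -` B \<inter> space M" unfolding sig by blast
  have b: "b \<in> sets (vimage_algebra (space M) R borel)"
    unfolding B(2) by (rule in_vimage_algebra[OF B(1)])
  show "prob (a \<inter> b) = prob a * prob b"
  proof (cases "j = 0")
    case True
    then have "a = space M \<or> a = {}" by (auto simp: A(2) c_0)
    moreover have "b \<in> events" unfolding B(2) using B(1) by measurable
    ultimately show ?thesis by (auto simp: prob_space Int_absorb1 sets.sets_into_space)
  next
    case False
    have "a = weight_vector N C -` ((\<lambda>p. snd p j) -` A \<inter> space vector_algebra) \<inter> space M"
      using False measurable_space[OF weights_measurable] by (auto simp: A(2) c_weight_vector)
    moreover have "(\<lambda>p. snd p j) -` A \<inter> space vector_algebra \<in> sets vector_algebra"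
      using coordinate_measurable[of j] False A(1) by (auto intro: measurable_sets)
    ultimately have "a \<in> sets (vimage_algebra (space M) (weight_vector N C) vector_algebra)"
      by (simp only: in_vimage_algebra)
    with b have "prob (b \<inter> a) = prob b * prob a"
      using independent unfolding indep_of_weights_def by (intro indep_setD)
    then show ?thesis by (simp add: Int_commute mult.commute)
  qed
qed

definition expected_count :: "real set \<Rightarrow> ennreal" where
  "expected_count A = (\<integral>\<^sup>+\<omega>. (\<Sum>\<^sub>\<infinity>j\<in>present (N \<omega>). indicator A (C j \<omega> * R \<omega>)) \<partial>M)"

lemma sgn_tail_borel [measurable]: "sgn_tail s u \<in> sets borel"
  unfolding sgn_tail_def by measurable

lemma expected_count_eq:
  assumes [measurable]: "A \<in> sets borel" and "0 \<notin> A"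
  shows "expected_count A = (\<Sum>j. \<integral>\<^sup>+\<omega>. indicator A (c j \<omega> * R \<omega>) \<partial>M)"
proof -
  have "expected_count A = (\<integral>\<^sup>+\<omega>. (\<integral>\<^sup>+j. indicator A (c j \<omega> * R \<omega>) \<partial>count_space UNIV) \<partial>M)"
    unfolding expected_count_def using \<open>0 \<notin> A\<close>
    by (intro nn_integral_cong infsum_present[of "\<lambda>x. indicator A (x * R _)"]) auto
  also have "\<dots> = (\<integral>\<^sup>+j. (\<integral>\<^sup>+\<omega>. indicator A (c j \<omega> * R \<omega>) \<partial>M) \<partial>count_space UNIV)"
    by (rule nn_integral_count_space_nn_integral) auto
  finally show ?thesis by (simp add: nn_integral_count_space_nat)
qed

lemma expected_count_sgn_tail:
  "0 \<le> u \<Longrightarrow> expected_count (sgn_tail s u) = (\<Sum>j. \<integral>\<^sup>+\<omega>. indicator (sgn_tail s u) (c j \<omega> * R \<omega>) \<partial>M)"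
  by (rule expected_count_eq) (auto simp: sgn_tail_def)

lemma expected_count_abs_tail:
  assumes "0 < u"
  shows "expected_count (abs_tail u) = expected_count (sgn_tail 1 u) + expected_count (sgn_tail (-1) u)"
proof -
  have borel: "abs_tail u \<in> sets borel" unfolding abs_tail_def by measurable
  have "indicator (abs_tail u) x = (indicator (sgn_tail 1 u) x + indicator (sgn_tail (-1) u) x :: ennreal)" for x
    using assms by (auto simp: indicator_def abs_tail_def sgn_tail_def abs_if)
  then have "(\<integral>\<^sup>+\<omega>. indicator (abs_tail u) (c j \<omega> * R \<omega>) \<partial>M) =
      (\<integral>\<^sup>+\<omega>. indicator (sgn_tail 1 u) (c j \<omega> * R \<omega>) \<partial>M) + (\<integral>\<^sup>+\<omega>. indicator (sgn_tail (-1) u) (c j \<omega> * R \<omega>) \<partial>M)" for j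
    by (simp add: nn_integral_add)
  then show ?thesis
    using assms borel
    by (subst expected_count_eq) (auto simp: abs_tail_def expected_count_sgn_tail suminf_add intro!: suminf_add[symmetric])
qed

text \<open>Conditioning on the weight: the product of the marginal laws is the joint law of \<open>c j\<close> and \<open>R\<close>.\<close>

lemma one_weight_tail:
  "(\<integral>\<^sup>+\<omega>. indicator (sgn_tail s u) (c j \<omega> * R \<omega>) \<partial>M) = (\<integral>\<^sup>+\<omega>. ennreal (tailP (s * c j \<omega>) u) \<partial>M)"
proof -
  have dist: "distr M borel (c j) \<Otimes>\<^sub>M distr M borel R = distr M (borel \<Otimes>\<^sub>M borel) (\<lambda>\<omega>. (c j \<omega>, R \<omega>))"
    using weight_indep[of j] by (simp add: indep_var_distribution_eq)
  interpret R: prob_space "distr M borel R" by (rule prob_space_distr) simp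
  have [measurable]: "(\<lambda>p. indicator (sgn_tail s u) (fst p * snd p) :: ennreal) \<in> borel_measurable (borel \<Otimes>\<^sub>M borel)"
    unfolding sgn_tail_def by measurable
  have "(\<integral>\<^sup>+\<omega>. indicator (sgn_tail s u) (c j \<omega> * R \<omega>) \<partial>M)
     = (\<integral>\<^sup>+p. indicator (sgn_tail s u) (fst p * snd p) \<partial>distr M (borel \<Otimes>\<^sub>M borel) (\<lambda>\<omega>. (c j \<omega>, R \<omega>)))"
    by (subst nn_integral_distr) auto
  also have "\<dots> = (\<integral>\<^sup>+x. (\<integral>\<^sup>+y. indicator (sgn_tail s u) (x * y) \<partial>distr M borel R) \<partial>distr M borel (c j))"
    unfolding dist[symmetric] by (subst R.nn_integral_fst[symmetric]) auto
  also have "\<dots> = (\<integral>\<^sup>+\<omega>. (\<integral>\<^sup>+y. indicator (sgn_tail s u) (c j \<omega> * y) \<partial>distr M borel R) \<partial>M)"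
    by (subst nn_integral_distr) (auto intro!: R.borel_measurable_nn_integral)
  also have "\<dots> = (\<integral>\<^sup>+\<omega>. ennreal (tailP (s * c j \<omega>) u) \<partial>M)"
  proof (rule nn_integral_cong)
    fix \<omega>
    have "(\<integral>\<^sup>+y. indicator (sgn_tail s u) (c j \<omega> * y) \<partial>distr M borel R)
      = (\<integral>\<^sup>+\<omega>'. indicator (sgn_tail s u) (c j \<omega> * R \<omega>') \<partial>M)"
      unfolding sgn_tail_def by (subst nn_integral_distr) auto
    also have "\<dots> = (\<integral>\<^sup>+\<omega>'. indicator {\<omega>' \<in> space M. (s * c j \<omega>) * R \<omega>' > u} \<omega>' \<partial>M)"
      by (intro nn_integral_cong) (auto simp: sgn_tail_def indicator_def mult.assoc)
    also have "\<dots> = ennreal (tailP (s * c j \<omega>) u)"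
      by (simp add: tailP_def emeasure_eq_measure)
    finally show "(\<integral>\<^sup>+y. indicator (sgn_tail s u) (c j \<omega> * y) \<partial>distr M borel R) = ennreal (tailP (s * c j \<omega>) u)" .
  qed
  finally show ?thesis .
qed

lemma tailP_measurable: "(\<lambda>x. tailP (s * x) u) \<in> borel_measurable borel"
proof -
  have "(\<lambda>x. \<integral>\<^sup>+\<omega>. indicator {\<omega> \<in> space M. s * x * R \<omega> > u} \<omega> \<partial>M) \<in> borel_measurable borel"
    by (rule borel_measurable_nn_integral) measurable
  then have "(\<lambda>x. enn2real (\<integral>\<^sup>+\<omega>. indicator {\<omega> \<in> space M. s * x * R \<omega> > u} \<omega> \<partial>M)) \<in> borel_measurable borel"
    by measurable
  then show ?thesis by (simp add: tailP_def measure_def)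
qed

lemma tailP_measurable_u: "(\<lambda>u. tailP s u) \<in> borel_measurable borel"
proof -
  have "(\<lambda>u. \<integral>\<^sup>+\<omega>. indicator {\<omega> \<in> space M. s * R \<omega> > u} \<omega> \<partial>M) \<in> borel_measurable borel"
    by (rule borel_measurable_nn_integral) measurable
  then have "(\<lambda>u. enn2real (\<integral>\<^sup>+\<omega>. indicator {\<omega> \<in> space M. s * R \<omega> > u} \<omega> \<partial>M)) \<in> borel_measurable borel"
    by measurable
  then show ?thesis by (simp add: tailP_def measure_def)
qed

lemma tailP_scale: "0 < a \<Longrightarrow> tailP (s * a) u = tailP s (u / a)"
  unfolding tailP_def by (intro arg_cong[of _ _ prob]) (auto simp: field_simps)

lemma tailP_zero: "0 \<le> u \<Longrightarrow> tailP 0 u = 0"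
  by (simp add: tailP_def)

text \<open>The normalised tail of \<open>R\<close> (\<open>s = 1\<close>) or of \<open>- R\<close> (\<open>s = - 1\<close>) along the lattice through \<open>t\<close>.\<close>

definition \<rho> :: "real \<Rightarrow> real \<Rightarrow> int \<Rightarrow> real" where
  "\<rho> t s n = exp (\<alpha> * (t + of_int n * l)) * tailP s (exp (t + of_int n * l))"

lemma \<rho>_nonneg: "0 \<le> \<rho> t s n" by (simp add: \<rho>_def tailP_def)

lemma \<rho>_measurable [measurable]: "(\<lambda>z. \<rho> t (s * e z) (n - X z)) \<in> borel_measurable tilted"
proof -
  have "(\<lambda>z. if w z < 0 then \<rho> t (- s) (n - X z) else \<rho> t s (n - X z)) \<in> borel_measurable tilted"
    by measurable
  moreover have "(\<lambda>z. if w z < 0 then \<rho> t (- s) (n - X z) else \<rho> t s (n - X z)) = (\<lambda>z. \<rho> t (s * e z) (n - X z))"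
    by (auto simp: e_def fun_eq_iff)
  ultimately show ?thesis by simp
qed

text \<open>By conditioning, the expected count is \<open>E[\<Sum>\<^sub>j P(s c\<^sub>j R > u \<bar> c\<^sub>j)]\<close>. Division by \<open>\<bar>c\<^sub>j\<bar>\<^sup>\<alpha> = exp (\<alpha> l X)\<close>
  passes to the tilted measure, and scaling out the modulus of the weight shifts the index by \<open>X\<close>.\<close>

lemma expected_count_tilted:
  "ennreal (exp (\<alpha> * (t + of_int n * l))) * expected_count (sgn_tail s (exp (t + of_int n * l)))
     = (\<integral>\<^sup>+z. ennreal (\<rho> t (s * e z) (n - X z)) \<partial>tilted)"
proof -
  define u where "u = exp (t + of_int n * l)"
  have [measurable]: "(\<lambda>x. tailP (s * x) u) \<in> borel_measurable borel" by (rule tailP_measurable)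
  have "expected_count (sgn_tail s u) = (\<Sum>j. \<integral>\<^sup>+\<omega>. ennreal (tailP (s * c j \<omega>) u) \<partial>M)"
    by (simp add: expected_count_sgn_tail one_weight_tail u_def)
  also have "\<dots> = (\<integral>\<^sup>+\<omega>. (\<integral>\<^sup>+j. ennreal (tailP (s * c j \<omega>) u) \<partial>count_space UNIV) \<partial>M)"
    unfolding nn_integral_count_space_nat[symmetric]
    by (rule nn_integral_count_space_nn_integral[symmetric]) auto
  also have "\<dots> = (\<integral>\<^sup>+\<omega>. (\<integral>\<^sup>+j. ennreal (\<bar>c j \<omega>\<bar> powr \<alpha>) *
      ennreal (\<bar>c j \<omega>\<bar> powr (- \<alpha>) * tailP (s * c j \<omega>) u) \<partial>count_space UNIV) \<partial>M)"
  proof (intro nn_integral_cong)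
    fix \<omega> and j :: nat
    have eq: "\<bar>c j \<omega>\<bar> powr \<alpha> * (\<bar>c j \<omega>\<bar> powr (- \<alpha>) * tailP (s * c j \<omega>) u) = tailP (s * c j \<omega>) u"
      by (cases "c j \<omega> = 0") (auto simp: u_def tailP_zero mult.assoc[symmetric] powr_add[symmetric])
    show "ennreal (tailP (s * c j \<omega>) u) = ennreal (\<bar>c j \<omega>\<bar> powr \<alpha>) *
      ennreal (\<bar>c j \<omega>\<bar> powr (- \<alpha>) * tailP (s * c j \<omega>) u)"
      by (subst ennreal_mult'[symmetric]) (simp, simp only: eq)
  qed
  also have "\<dots> = (\<integral>\<^sup>+z. ennreal (\<bar>w z\<bar> powr (- \<alpha>) * tailP (s * w z) u) \<partial>tilted)"
    by (subst nn_integral_tilted) auto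
  finally have "ennreal (exp (\<alpha> * (t + of_int n * l))) * expected_count (sgn_tail s u)
    = (\<integral>\<^sup>+z. ennreal (exp (\<alpha> * (t + of_int n * l))) * ennreal (\<bar>w z\<bar> powr (- \<alpha>) * tailP (s * w z) u) \<partial>tilted)"
    by (simp add: nn_integral_cmult)
  also have "\<dots> = (\<integral>\<^sup>+z. ennreal (\<rho> t (s * e z) (n - X z)) \<partial>tilted)"
  proof (rule nn_integral_cong_AE)
    show "AE z in tilted. ennreal (exp (\<alpha> * (t + of_int n * l))) * ennreal (\<bar>w z\<bar> powr (- \<alpha>) * tailP (s * w z) u)
       = ennreal (\<rho> t (s * e z) (n - X z))"
      using AE_w AE_w_nonzero
    proof eventually_elim
      case (elim z)
      have 1: "\<bar>w z\<bar> powr (- \<alpha>) = exp (- \<alpha> * (l * X z))"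
        using elim(1)[THEN conjunct1] elim(2) by (simp add: powr_def)
      have "tailP (s * w z) u = tailP (s * e z * exp (l * X z)) u"
        using elim by (simp add: mult.assoc)
      also have "\<dots> = tailP (s * e z) (exp (t + of_int (n - X z) * l))"
        by (subst tailP_scale) (auto simp: u_def algebra_simps simp flip: exp_diff)
      finally have "exp (\<alpha> * (t + of_int n * l)) * (\<bar>w z\<bar> powr (- \<alpha>) * tailP (s * w z) u) = \<rho> t (s * e z) (n - X z)"
        unfolding 1 \<rho>_def by (simp add: algebra_simps flip: exp_add)
      then show ?case by (simp add: ennreal_mult'[symmetric])
    qed
  qed
  finally show ?thesis by (simp add: u_def)
qed

text \<open>Markov's inequality for the moment of order \<open>b\<close>.\<close>

lemma \<rho>_bound:
  assumes lm: "lower_moments_finite M \<alpha> (\<lambda>\<omega>. max (s * R \<omega>) 0)" and b: "0 < b" "b < \<alpha>"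
  obtains K where "\<And>n. \<rho> t s n \<le> K * exp ((\<alpha> - b) * l * of_int n)"
proof
  let ?m = "enn2real (\<integral>\<^sup>+\<omega>. ennreal (max (s * R \<omega>) 0 powr b) \<partial>M)"
  fix n
  define u where "u = exp (t + of_int n * l)"
  have u: "0 < u" by (simp add: u_def)
  have fin: "(\<integral>\<^sup>+\<omega>. ennreal (max (s * R \<omega>) 0 powr b) \<partial>M) < \<infinity>"
    using lm b by (simp add: lower_moments_finite_def)
  have "ennreal (u powr b * tailP s u) = ennreal (u powr b) * ennreal (tailP s u)"
    by (simp add: ennreal_mult')
  also have "\<dots> = (\<integral>\<^sup>+\<omega>. ennreal (u powr b) * indicator {\<omega> \<in> space M. s * R \<omega> > u} \<omega> \<partial>M)"
    by (subst nn_integral_cmult_indicator) (auto simp: tailP_def emeasure_eq_measure)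
  also have "\<dots> \<le> (\<integral>\<^sup>+\<omega>. ennreal (max (s * R \<omega>) 0 powr b) \<partial>M)"
    using u b by (intro nn_integral_mono) (auto simp: indicator_def intro!: ennreal_leI powr_mono2)
  also have "\<dots> = ennreal ?m" using fin by (simp add: less_top)
  finally have le: "u powr b * tailP s u \<le> ?m" by (simp add: ennreal_le_iff)
  have "\<rho> t s n = exp ((\<alpha> - b) * (t + of_int n * l)) * (u powr b * tailP s u)"
    unfolding \<rho>_def u_def by (simp add: powr_def algebra_simps flip: exp_add)
  also have "\<dots> \<le> exp ((\<alpha> - b) * (t + of_int n * l)) * ?m" using le by (intro mult_left_mono) auto
  also have "\<dots> = (?m * exp ((\<alpha> - b) * t)) * exp ((\<alpha> - b) * l * of_int n)"
    by (simp add: algebra_simps flip: exp_add)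
  finally show "\<rho> t s n \<le> (?m * exp ((\<alpha> - b) * t)) * exp ((\<alpha> - b) * l * of_int n)" .
qed

lemma tail_gap_sgn: "tail_gap M N C R (sgn_tail s u) = ereal (tailP s u) - enn2ereal (expected_count (sgn_tail s u))"
  by (simp add: tail_gap_def tailP_def expected_count_def sgn_tail_def)

lemma lattice_term_renewal:
  assumes int: "integrable tilted (\<lambda>z. \<rho> t (s * e z) (n - X z))"
  shows "expected_count (sgn_tail s (exp (t + of_int n * l))) < \<infinity>"
    and "\<rho> t s n = lattice_term M N C R \<alpha> l (sgn_tail s) t n + (\<integral>z. \<rho> t (s * e z) (n - X z) \<partial>tilted)"
proof -
  let ?E = "exp (\<alpha> * (t + of_int n * l))" and ?c = "expected_count (sgn_tail s (exp (t + of_int n * l)))"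
  have eq: "ennreal ?E * ?c = ennreal (\<integral>z. \<rho> t (s * e z) (n - X z) \<partial>tilted)"
    unfolding expected_count_tilted by (rule nn_integral_eq_integral[OF int]) (simp add: \<rho>_nonneg)
  then have "ennreal ?E * ?c < \<top>" by simp
  then show fin: "?c < \<infinity>" by (auto simp: ennreal_mult_less_top)
  then obtain x where x: "?c = ennreal x" "0 \<le> x" by (cases ?c) auto
  have "ennreal (?E * x) = ennreal (\<integral>z. \<rho> t (s * e z) (n - X z) \<partial>tilted)"
    using eq x by (simp add: ennreal_mult)
  then have "?E * x = (\<integral>z. \<rho> t (s * e z) (n - X z) \<partial>tilted)"
    using x by (subst (asm) ennreal_inj) (auto intro!: integral_nonneg_AE simp: \<rho>_nonneg)
  moreover have "lattice_term M N C R \<alpha> l (sgn_tail s) t n = ?E * (tailP s (exp (t + of_int n * l)) - x)"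
    using x by (simp add: lattice_term_def tail_gap_sgn)
  ultimately show "\<rho> t s n = lattice_term M N C R \<alpha> l (sgn_tail s) t n + (\<integral>z. \<rho> t (s * e z) (n - X z) \<partial>tilted)"
    by (simp add: \<rho>_def algebra_simps)
qed

text \<open>The integral in \<open>gap_integrable\<close> is that of the absolute lattice sums over one period of \<open>t\<close>.\<close>

lemma lattice_term_summable:
  assumes "gap_integrable M N C R \<alpha> (sgn_tail s)"
  shows "AE t in lborel. integrable (count_space UNIV) (lattice_term M N C R \<alpha> l (sgn_tail s) t)"
proof -
  define F where "F u = e2ennreal \<bar>ereal (tailP s u) - enn2ereal (\<Sum>j. \<integral>\<^sup>+\<omega>. indicator (sgn_tail s u) (c j \<omega> * R \<omega>) \<partial>M)\<bar>" for u
  have [measurable]: "(\<lambda>u. \<integral>\<^sup>+\<omega>. indicator (sgn_tail s u) (c j \<omega> * R \<omega>) \<partial>M) \<in> borel_measurable borel" for j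
  proof (rule borel_measurable_nn_integral)
    have "(\<lambda>(u, \<omega>). indicator {p. s * (c j (snd p) * R (snd p)) > fst p} (u, \<omega>) :: ennreal) \<in> borel_measurable (borel \<Otimes>\<^sub>M M)"
      by measurable
    then show "(\<lambda>(u, \<omega>). indicator (sgn_tail s u) (c j \<omega> * R \<omega>) :: ennreal) \<in> borel_measurable (borel \<Otimes>\<^sub>M M)"
      by (simp add: sgn_tail_def indicator_def)
  qed
  have [measurable]: "F \<in> borel_measurable borel"
    unfolding F_def using tailP_measurable_u by measurable
  have F: "F u = e2ennreal \<bar>tail_gap M N C R (sgn_tail s u)\<bar>" if "0 < u" for u
    using that by (simp add: F_def tail_gap_sgn expected_count_sgn_tail)
  have "(\<integral>\<^sup>+u\<in>{0<..}. F u * ennreal (u powr (\<alpha> - 1)) \<partial>lborel)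
    = (\<integral>\<^sup>+u\<in>{0<..}. e2ennreal \<bar>tail_gap M N C R (sgn_tail s u)\<bar> * ennreal (u powr (\<alpha> - 1)) \<partial>lborel)"
    by (intro nn_integral_cong) (auto simp: indicator_def F)
  also have "\<dots> < \<infinity>" using assms by (simp add: gap_integrable_def)
  finally have "AE t in lborel. (\<integral>\<^sup>+k. ennreal (exp (\<alpha> * (t + real_of_int k * l))) * F (exp (t + real_of_int k * l))
           \<partial>count_space UNIV) < \<infinity>"
    by (intro AE_lattice_summable l_pos) simp_all
  then show ?thesis
  proof eventually_elim
    case (elim t)
    show ?case
    proof (rule integrableI_bounded)
      have "(\<integral>\<^sup>+k. ennreal (norm (lattice_term M N C R \<alpha> l (sgn_tail s) t k)) \<partial>count_space UNIV)
        \<le> (\<integral>\<^sup>+k. ennreal (exp (\<alpha> * (t + real_of_int k * l))) * F (exp (t + real_of_int k * l)) \<partial>count_space UNIV)"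
      proof (intro nn_integral_mono)
        fix k
        let ?g = "tail_gap M N C R (sgn_tail s (exp (t + real_of_int k * l)))"
        have "ennreal \<bar>real_of_ereal ?g\<bar> \<le> e2ennreal \<bar>?g\<bar>"
          by (cases ?g) (auto simp: e2ennreal_ereal)
        then show "ennreal (norm (lattice_term M N C R \<alpha> l (sgn_tail s) t k))
          \<le> ennreal (exp (\<alpha> * (t + real_of_int k * l))) * F (exp (t + real_of_int k * l))"
          by (auto simp: lattice_term_def abs_mult ennreal_mult' F intro!: mult_left_mono)
      qed
      with elim show "(\<integral>\<^sup>+k. ennreal (norm (lattice_term M N C R \<alpha> l (sgn_tail s) t k)) \<partial>count_space UNIV) < \<infinity>"
        by (rule le_less_trans[rotated])
    qed simp
  qed
qed

end

section \<open>Tail asymptotics\<close>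

lemma summable_on_of_integrable_count_space:
  assumes "integrable (count_space UNIV) (f :: 'i \<Rightarrow> real)"
  shows "f summable_on UNIV"
proof -
  have "Infinite_Set_Sum.abs_summable_on f UNIV"
    using assms by (simp add: Infinite_Set_Sum.abs_summable_on_def)
  then have "Infinite_Sum.abs_summable_on f UNIV" using abs_summable_equivalent by blast
  then show ?thesis by (rule abs_summable_summable)
qed

context weighted_branching begin

lemma integrable_from_bound:
  assumes "integrable tilted (\<lambda>z. p (n - X z))" "\<And>m. \<rho> t s m \<le> p m" "\<And>m. \<rho> t (- s) m \<le> p m"
  shows "integrable tilted (\<lambda>z. \<rho> t (s * e z) (n - X z))"
proof (rule Bochner_Integration.integrable_bound[OF assms(1)])
  show "AE z in tilted. norm (\<rho> t (s * e z) (n - X z)) \<le> norm (p (n - X z))"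
    using assms(2,3) \<rho>_nonneg by (intro AE_I2) (auto simp: e_def intro: order_trans[OF _ abs_ge_self])
qed measurable

text \<open>The exponent \<open>\<theta>\<close> stays below \<open>(\<alpha> - \<gamma>) l\<close>, so the order \<open>b = \<alpha> - \<theta> / l\<close> lies between \<open>\<gamma> \<ge> 0\<close>
  and \<open>\<alpha>\<close>; a moment of \<open>R\<close> of that order gives its normalised tail the growth \<open>exp (\<theta> n)\<close>.\<close>

lemma contracting_exponent:
  assumes drift: "0 < weight_drift M N C \<alpha>"
  obtains b where "0 < b" "b < \<alpha>" "drifting_walk tilted X ((\<alpha> - b) * l)"
proof -
  interpret Q: prob_space tilted by (rule prob_space_tilted)
  have scale: "(\<integral>\<^sup>+z. ennreal (l * x z) \<partial>tilted) = ennreal l * (\<integral>\<^sup>+z. ennreal (x z) \<partial>tilted)"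
    if [measurable]: "x \<in> borel_measurable tilted" for x
    using l_pos by (simp add: ennreal_mult' nn_integral_cmult)
  define p m where "p = (\<integral>\<^sup>+z. ennreal (real_of_int (X z)) \<partial>tilted)"
    and "m = (\<integral>\<^sup>+z. ennreal (- real_of_int (X z)) \<partial>tilted)"
  have "enn2ereal (ennreal l * p) - enn2ereal (ennreal l * m) > 0"
    using drift scale[of "\<lambda>z. real_of_int (X z)"] scale[of "\<lambda>z. - real_of_int (X z)"]
    by (simp add: drift_eq(1) p_def m_def)
  moreover have "ennreal l * m < \<infinity>"
    using drift_eq(2) scale[of "\<lambda>z. - real_of_int (X z)"] by (simp add: m_def)
  ultimately have "ennreal l * m < ennreal l * p"
    by (cases "ennreal l * m"; cases "ennreal l * p") (auto simp: ennreal_less_iff)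
  then have "m < p" by (metis mult_left_mono not_less zero_le)
  then obtain \<theta> where \<theta>: "0 < \<theta>" "\<theta> < (\<alpha> - \<gamma>) * l" "integrable tilted (\<lambda>z. exp (- \<theta> * X z))"
      "Q.expectation (\<lambda>z. exp (- \<theta> * X z)) < 1"
    using Q.exists_contracting_exponent[of "\<lambda>z. real_of_int (X z)" "(\<alpha> - \<gamma>) * l"] exp_moment l_pos \<gamma>_less
    by (auto simp: p_def m_def)
  show thesis
  proof (rule that[of "\<alpha> - \<theta> / l"])
    show "\<alpha> - \<theta> / l < \<alpha>" using \<theta>(1) l_pos by simp
    have "\<theta> / l < \<alpha> - \<gamma>" using \<theta>(2) l_pos by (simp add: field_simps)
    then show "0 < \<alpha> - \<theta> / l" using \<gamma>_nonneg by simp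
    have "(\<alpha> - (\<alpha> - \<theta> / l)) * l = \<theta>" using l_pos by simp
    then show "drifting_walk tilted X ((\<alpha> - (\<alpha> - \<theta> / l)) * l)"
      by (auto intro!: drifting_walk.intro drifting_walk_axioms.intro prob_space_tilted \<theta>)
  qed
qed

lemma drift_cases:
  assumes drift: "0 < weight_drift M N C \<alpha>"
  shows "if integrable tilted (\<lambda>z. real_of_int (X z))
    then weight_drift M N C \<alpha> = ereal (l * (\<integral>z. real_of_int (X z) \<partial>tilted)) \<and> (\<integral>z. real_of_int (X z) \<partial>tilted) > 0
    else weight_drift M N C \<alpha> = \<infinity>"
proof (cases "integrable tilted (\<lambda>z. real_of_int (X z))")
  case True
  then have int: "integrable tilted (\<lambda>z. l * real_of_int (X z))" by simp
  define p m where "p = (\<integral>\<^sup>+z. ennreal (l * X z) \<partial>tilted)" and "m = (\<integral>\<^sup>+z. ennreal (- (l * X z)) \<partial>tilted)"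
  have fin: "p \<noteq> \<infinity>" "m \<noteq> \<infinity>" using int[unfolded real_integrable_def] by (auto simp: p_def m_def)
  have "weight_drift M N C \<alpha> = ereal (enn2real p - enn2real m)"
    using fin by (cases p; cases m) (auto simp: drift_eq(1) p_def[symmetric] m_def[symmetric])
  also have "enn2real p - enn2real m = (\<integral>z. l * real_of_int (X z) \<partial>tilted)"
    unfolding p_def m_def by (rule real_lebesgue_integral_def[OF int, symmetric])
  also have "\<dots> = l * (\<integral>z. real_of_int (X z) \<partial>tilted)" by simp
  finally show ?thesis using True drift l_pos by (simp add: zero_less_mult_iff)
next
  case False
  have ni: "\<not> integrable tilted (\<lambda>z. l * real_of_int (X z))" using False l_pos by simp
  have "(\<lambda>z. l * real_of_int (X z)) \<in> borel_measurable tilted" by measurable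
  then have "(\<integral>\<^sup>+z. ennreal (l * X z) \<partial>tilted) = \<infinity>"
    using ni[unfolded real_integrable_def] drift_eq(2) by auto
  then show ?thesis using False drift_eq by (simp add: less_top[symmetric])
qed

text \<open>The finite and the infinite mean in one formula, \<open>l / \<infinity>\<close> being \<open>0\<close>.\<close>

lemma renewal_limit:
  assumes drift: "0 < weight_drift M N C \<alpha>"
    and walk: "drifting_walk tilted X \<theta>"
    and g: "integrable (count_space UNIV) g"
    and r0: "\<And>n. 0 \<le> r n" and rK: "\<And>n. r n \<le> K * exp (\<theta> * real_of_int n)"
    and renewal: "\<And>n. r n = g n + (\<integral>z. r (n - X z) \<partial>tilted)"
  shows "(r \<longlongrightarrow> real_of_ereal (ereal l / weight_drift M N C \<alpha>) * infsum g UNIV) at_top"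
proof -
  interpret W: drifting_walk tilted X \<theta> by (rule walk)
  have sum: "infsum g UNIV = (\<integral>n. g n \<partial>count_space UNIV)"
    using infsetsum_infsum[of g UNIV] g by (simp add: Infinite_Set_Sum.abs_summable_on_def infsetsum_def)
  show ?thesis
  proof (cases "integrable tilted (\<lambda>z. real_of_int (X z))")
    case True
    then have d: "weight_drift M N C \<alpha> = ereal (l * (\<integral>z. real_of_int (X z) \<partial>tilted))"
      "(\<integral>z. real_of_int (X z) \<partial>tilted) > 0" using drift_cases[OF drift] by auto
    have "(r \<longlongrightarrow> (\<integral>n. g n \<partial>count_space UNIV) / (\<integral>z. real_of_int (X z) \<partial>tilted)) at_top"
      using W.renewal_limit_finite_mean[OF g r0 rK renewal X_span True] d(2) by simp
    then show ?thesis using d l_pos by (simp add: sum)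
  next
    case False
    then have "weight_drift M N C \<alpha> = \<infinity>" using drift_cases[OF drift] by simp
    then show ?thesis
      using W.renewal_limit_infinite_mean[OF g r0 rK renewal X_span False] by simp
  qed
qed

lemma exp_asymp_\<rho>:
  assumes "(\<rho> t s \<longlongrightarrow> h) at_top"
  shows "exp_asymp \<alpha> l t (\<lambda>n. measure M {\<omega> \<in> space M. R \<omega> \<in> sgn_tail s (exp (t + l * real n))}) h"
  using assms unfolding tendsto_int_at_top_iff exp_asymp_def
  by (simp add: \<rho>_def tailP_def sgn_tail_def mult.commute)

lemma nonneg_weights_limit:
  assumes drift: "0 < weight_drift M N C \<alpha>" and nn: "weights_nonneg M N C"
    and lm: "lower_moments_finite M \<alpha> (\<lambda>\<omega>. max (s * R \<omega>) 0)"
    and gi: "gap_integrable M N C R \<alpha> (sgn_tail s)"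
  shows "AE t in lborel. lattice_term M N C R \<alpha> l (sgn_tail s) t summable_on UNIV \<and>
      0 \<le> lattice_H M N C R \<alpha> l (weight_drift M N C \<alpha>) (sgn_tail s) t \<and>
      exp_asymp \<alpha> l t (\<lambda>n. measure M {\<omega> \<in> space M. R \<omega> \<in> sgn_tail s (exp (t + l * real n))})
        (lattice_H M N C R \<alpha> l (weight_drift M N C \<alpha>) (sgn_tail s) t)"
  using lattice_term_summable[OF gi]
proof eventually_elim
  case (elim t)
  obtain b where b: "0 < b" "b < \<alpha>" and walk: "drifting_walk tilted X ((\<alpha> - b) * l)"
    using contracting_exponent[OF drift] .
  obtain K where K: "\<And>n. \<rho> t s n \<le> K * exp ((\<alpha> - b) * l * of_int n)" using \<rho>_bound[OF lm b] by blast
  interpret W: drifting_walk tilted X "(\<alpha> - b) * l" by (rule walk)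
  have "AE z in tilted. w z \<in> {0..}"
    using nn by (subst AE_tilted_iff) (auto simp: nonzero_weights_in_def weights_nonneg_def elim!: eventually_mono)
  then have e1: "AE z in tilted. \<rho> t (s * e z) (n - X z) = \<rho> t s (n - X z)" for n
    by eventually_elim (simp add: e_def)
  have int': "integrable tilted (\<lambda>z. \<rho> t s (n - X z))" for n
    by (rule W.integrable_shift[of "\<rho> t s" K]) (use K \<rho>_nonneg in auto)
  have int: "integrable tilted (\<lambda>z. \<rho> t (s * e z) (n - X z))" for n
    using integrable_cong_AE[OF _ _ e1, of n] int'[of n] by simp
  have renewal: "\<rho> t s n = lattice_term M N C R \<alpha> l (sgn_tail s) t n + (\<integral>z. \<rho> t s (n - X z) \<partial>tilted)" for n
    using lattice_term_renewal(2)[OF int, of n] integral_cong_AE[OF _ _ e1, of n] by simp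
  have lim: "(\<rho> t s \<longlongrightarrow> lattice_H M N C R \<alpha> l (weight_drift M N C \<alpha>) (sgn_tail s) t) at_top"
    unfolding lattice_H_def
    by (rule renewal_limit[OF drift walk elim \<rho>_nonneg K renewal])
  moreover have "0 \<le> lattice_H M N C R \<alpha> l (weight_drift M N C \<alpha>) (sgn_tail s) t"
    by (rule tendsto_lowerbound[OF lim]) (auto simp: \<rho>_nonneg)
  ultimately show ?case using elim by (auto intro: exp_asymp_\<rho> summable_on_of_integrable_count_space)
qed

lemma lattice_term_abs_tail:
  assumes "expected_count (sgn_tail 1 (exp (t + of_int k * l))) < \<infinity>"
    "expected_count (sgn_tail (-1) (exp (t + of_int k * l))) < \<infinity>"
  shows "lattice_term M N C R \<alpha> l abs_tail t k =
    lattice_term M N C R \<alpha> l (sgn_tail 1) t k + lattice_term M N C R \<alpha> l (sgn_tail (-1)) t k"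
proof -
  define u where "u = exp (t + of_int k * l)"
  have u: "0 < u" by (simp add: u_def)
  have P: "measure M {\<omega> \<in> space M. R \<omega> \<in> abs_tail u} = tailP 1 u + tailP (-1) u"
  proof -
    have "{\<omega> \<in> space M. R \<omega> \<in> abs_tail u} = {\<omega> \<in> space M. 1 * R \<omega> > u} \<union> {\<omega> \<in> space M. -1 * R \<omega> > u}"
      using u by (auto simp: abs_tail_def abs_if)
    then show ?thesis unfolding tailP_def using u by (subst finite_measure_Union[symmetric]) auto
  qed
  obtain x y where x: "expected_count (sgn_tail 1 u) = ennreal x" "0 \<le> x"
    and y: "expected_count (sgn_tail (-1) u) = ennreal y" "0 \<le> y"
    using assms unfolding u_def[symmetric]
    by (cases "expected_count (sgn_tail 1 u)"; cases "expected_count (sgn_tail (-1) u)") auto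
  have "tail_gap M N C R (abs_tail u) = ereal (tailP 1 u + tailP (-1) u) - enn2ereal (expected_count (abs_tail u))"
    unfolding tail_gap_def P expected_count_def ..
  also have "\<dots> = ereal ((tailP 1 u - x) + (tailP (-1) u - y))"
    using x y u by (simp add: expected_count_abs_tail flip: ennreal_plus)
  finally show ?thesis
    using x y unfolding lattice_term_def u_def[symmetric] tail_gap_sgn by (simp add: algebra_simps)
qed

text \<open>With \<open>p\<close> and \<open>d\<close> the sum and the difference of the two normalised tails, \<open>p\<close> solves the renewal
  equation with the unsigned steps and \<open>d\<close> the signed one, so \<open>p\<close> converges and \<open>d\<close> tends to \<open>0\<close>.\<close>

lemma signed_weights_limit:
  assumes drift: "0 < weight_drift M N C \<alpha>"
    and neg: "\<exists>j\<ge>1. measure M {\<omega> \<in> space M. j \<in> present (N \<omega>) \<and> C j \<omega> < 0} > 0"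
    and locked: "\<not> sign_locked M N C l"
    and lm: "lower_moments_finite M \<alpha> (\<lambda>\<omega>. \<bar>R \<omega>\<bar>)"
    and gp: "gap_integrable M N C R \<alpha> (sgn_tail 1)" and gm: "gap_integrable M N C R \<alpha> (sgn_tail (-1))"
  defines "\<mu> \<equiv> weight_drift M N C \<alpha>"
  defines "H \<equiv> lattice_H M N C R \<alpha> l (2 * \<mu>) abs_tail"
  shows "AE t in lborel.
      lattice_term M N C R \<alpha> l (sgn_tail 1) t summable_on UNIV \<and>
      lattice_term M N C R \<alpha> l (sgn_tail (-1)) t summable_on UNIV \<and>
      lattice_term M N C R \<alpha> l abs_tail t summable_on UNIV \<and>
      0 \<le> H t \<and>
      H t = (lattice_H M N C R \<alpha> l \<mu> (sgn_tail 1) t + lattice_H M N C R \<alpha> l \<mu> (sgn_tail (-1)) t) / 2 \<and>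
      exp_asymp \<alpha> l t (\<lambda>n. measure M {\<omega> \<in> space M. R \<omega> \<in> sgn_tail 1 (exp (t + l * real n))}) (H t) \<and>
      exp_asymp \<alpha> l t (\<lambda>n. measure M {\<omega> \<in> space M. R \<omega> \<in> sgn_tail (-1) (exp (t + l * real n))}) (H t)"
  using lattice_term_summable[OF gp] lattice_term_summable[OF gm]
proof eventually_elim
  case (elim t)
  obtain b where b: "0 < b" "b < \<alpha>" and walk: "drifting_walk tilted X ((\<alpha> - b) * l)"
    using contracting_exponent[OF drift] .
  interpret W: drifting_walk tilted X "(\<alpha> - b) * l" by (rule walk)
  let ?g = "\<lambda>s. lattice_term M N C R \<alpha> l (sgn_tail s) t"
  have lms: "lower_moments_finite M \<alpha> (\<lambda>\<omega>. max (s * R \<omega>) 0)" if "s = 1 \<or> s = -1" for s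
    unfolding lower_moments_finite_def
  proof (intro allI impI)
    fix b assume b: "0 < b \<and> b < \<alpha>"
    have "(\<integral>\<^sup>+\<omega>. ennreal (max (s * R \<omega>) 0 powr b) \<partial>M) \<le> (\<integral>\<^sup>+\<omega>. ennreal (\<bar>R \<omega>\<bar> powr b) \<partial>M)"
      using b that by (intro nn_integral_mono ennreal_leI powr_mono2) auto
    also have "\<dots> < \<infinity>" using lm b by (simp add: lower_moments_finite_def)
    finally show "(\<integral>\<^sup>+\<omega>. ennreal (max (s * R \<omega>) 0 powr b) \<partial>M) < \<infinity>" .
  qed
  obtain K1 where K1: "\<And>n. \<rho> t 1 n \<le> K1 * exp ((\<alpha> - b) * l * of_int n)"
    using \<rho>_bound[OF lms b] by blast
  obtain K2 where K2: "\<And>n. \<rho> t (-1) n \<le> K2 * exp ((\<alpha> - b) * l * of_int n)"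
    using \<rho>_bound[OF lms b] by blast
  define p d where "p n = \<rho> t 1 n + \<rho> t (-1) n" and "d n = \<rho> t 1 n - \<rho> t (-1) n" for n
  define g where "g n = ?g 1 n + ?g (-1) n" for n
  have p0: "0 \<le> p n" for n by (simp add: p_def \<rho>_nonneg)
  have pK: "p n \<le> (K1 + K2) * exp ((\<alpha> - b) * l * of_int n)" for n
    using K1[of n] K2[of n] by (simp add: p_def algebra_simps)
  have pint: "integrable tilted (\<lambda>z. p (n - X z))" for n
    by (rule W.integrable_shift[of p "K1 + K2"]) (use pK p0 in auto)
  have le_p: "\<rho> t 1 m \<le> p m" "\<rho> t (-1) m \<le> p m" for m by (auto simp: p_def \<rho>_nonneg)
  have intp: "integrable tilted (\<lambda>z. \<rho> t (1 * e z) (n - X z))" for n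
    by (rule integrable_from_bound[OF pint]) (auto simp: le_p)
  have intm: "integrable tilted (\<lambda>z. \<rho> t (-1 * e z) (n - X z))" for n
    by (rule integrable_from_bound[OF pint]) (auto simp: le_p)
  note ren = lattice_term_renewal(2)[OF intp] lattice_term_renewal(2)[OF intm]
  have g_abs: "lattice_term M N C R \<alpha> l abs_tail t = g"
    by (rule ext, unfold g_def, rule lattice_term_abs_tail)
      (rule lattice_term_renewal(1)[OF intp] lattice_term_renewal(1)[OF intm])+
  have gint: "integrable (count_space UNIV) g" unfolding g_def using elim by (rule Bochner_Integration.integrable_add)
  have pren: "p n = g n + (\<integral>z. p (n - X z) \<partial>tilted)" for n
  proof -
    have "(\<integral>z. p (n - X z) \<partial>tilted) = (\<integral>z. \<rho> t (1 * e z) (n - X z) + \<rho> t (-1 * e z) (n - X z) \<partial>tilted)"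
      by (intro Bochner_Integration.integral_cong) (auto simp: p_def e_def)
    then show ?thesis using ren[of n] intp[of n] intm[of n] by (simp add: p_def g_def)
  qed
  have dren: "d n - (\<integral>z. e z * d (n - X z) \<partial>tilted) = ?g 1 n - ?g (-1) n" for n
  proof -
    have "(\<integral>z. e z * d (n - X z) \<partial>tilted) = (\<integral>z. \<rho> t (1 * e z) (n - X z) - \<rho> t (-1 * e z) (n - X z) \<partial>tilted)"
      by (intro Bochner_Integration.integral_cong) (auto simp: d_def e_def)
    then show ?thesis using ren[of n] intp[of n] intm[of n] by (simp add: d_def)
  qed
  have plim: "(p \<longlongrightarrow> real_of_ereal (ereal l / \<mu>) * infsum g UNIV) at_top"
    unfolding \<mu>_def by (rule renewal_limit[OF drift walk gint p0 pK pren])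
  obtain B where B: "\<And>n. p n \<le> B" using W.renewal_bounded[OF gint p0 pK pren] by blast
  have dlim: "(d \<longlongrightarrow> 0) at_top"
  proof (rule W.signed_liouville[OF X_measurable e_measurable abs_e _ _ X_span])
    show "\<bar>d n\<bar> \<le> B" for n
      using B[of n] \<rho>_nonneg[of t 1 n] \<rho>_nonneg[of t "-1" n] by (simp add: d_def p_def abs_if)
    have "((\<lambda>n. ?g 1 n - ?g (-1) n) \<longlongrightarrow> 0 - 0) at_top"
      by (intro tendsto_diff integrable_int_tendsto_zero elim)
    then show "((\<lambda>n. d n - W.expectation (\<lambda>z. e z * d (n - X z))) \<longlongrightarrow> 0) at_top"
      by (simp add: dren)
    fix s :: real assume s: "s \<in> {1, -1}"
    show "\<not> (AE z in tilted. e z = s powi X z)"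
    proof
      assume es: "AE z in tilted. e z = s powi X z"
      show False
      proof (cases "s = 1")
        case True
        have "AE z in tilted. w z \<in> {0..}"
          using es by eventually_elim (use True in \<open>auto simp: e_def split: if_splits\<close>)
        then have *: "nonzero_weights_in M N C {0..}" by (subst (asm) AE_tilted_iff) auto
        obtain j where j: "measure M {\<omega> \<in> space M. j \<in> present (N \<omega>) \<and> C j \<omega> < 0} > 0" using neg by blast
        have "AE \<omega> in M. \<omega> \<notin> {\<omega> \<in> space M. j \<in> present (N \<omega>) \<and> C j \<omega> < 0}"
          using *[unfolded nonzero_weights_in_def, rule_format, of j] by eventually_elim auto
        moreover have "{\<omega> \<in> space M. j \<in> present (N \<omega>) \<and> C j \<omega> < 0} = {\<omega> \<in> space M. c j \<omega> < 0}"
          by (auto simp: c_def)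
        ultimately have "measure M {\<omega> \<in> space M. j \<in> present (N \<omega>) \<and> C j \<omega> < 0} = 0"
          by (intro measure_eq_0_null_sets AE_iff_null_sets[THEN iffD2]) auto
        with j show False by simp
      next
        case False
        then have s: "s = -1" using s by simp
        let ?S = "{(- exp l) powi k | k :: int. True}"
        have "?S = range (\<lambda>k::int. (- exp l) powi k)" by auto
        then have S: "?S \<in> sets borel" by (intro borel_countable_set) simp
        have "AE z in tilted. w z \<in> ?S" using es AE_w
        proof eventually_elim
          case (elim z)
          have "(- exp l) powi X z = (-1) powi X z * exp l powi X z"
            by (metis mult_minus1 power_int_mult_distrib)
          also have "exp l powi X z = exp (l * X z)"
            by (simp add: exp_power_int mult.commute)
          finally have "w z = (- exp l) powi X z" using elim s by simp
          then show ?case by blast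
        qed
        then have "sign_locked M N C l"
          by (subst (asm) AE_tilted_iff[OF S]) (simp add: sign_locked_def)
        with locked show False by simp
      qed
    qed
  qed
  let ?h = "real_of_ereal (ereal l / \<mu>) * infsum g UNIV / 2"
  have "((\<lambda>n. (p n + d n) / 2) \<longlongrightarrow> (real_of_ereal (ereal l / \<mu>) * infsum g UNIV + 0) / 2) at_top"
    by (intro tendsto_intros plim dlim) simp
  then have lim1: "(\<rho> t 1 \<longlongrightarrow> ?h) at_top" by (simp add: p_def d_def)
  have "((\<lambda>n. (p n - d n) / 2) \<longlongrightarrow> (real_of_ereal (ereal l / \<mu>) * infsum g UNIV - 0) / 2) at_top"
    by (intro tendsto_intros plim dlim) simp
  then have lim2: "(\<rho> t (-1) \<longlongrightarrow> ?h) at_top" by (simp add: p_def d_def)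
  have half: "real_of_ereal (ereal l / (2 * \<mu>)) = real_of_ereal (ereal l / \<mu>) / 2"
    using drift by (cases \<mu>) (auto simp: \<mu>_def)
  have H: "H t = ?h" unfolding H_def lattice_H_def g_abs half by simp
  have sums: "?g 1 summable_on UNIV" "?g (-1) summable_on UNIV" "g summable_on UNIV"
    using elim gint by (auto intro: summable_on_of_integrable_count_space)
  have "infsum g UNIV = infsum (?g 1) UNIV + infsum (?g (-1)) UNIV"
    unfolding g_def using sums by (intro infsum_add)
  then have "H t = (lattice_H M N C R \<alpha> l \<mu> (sgn_tail 1) t + lattice_H M N C R \<alpha> l \<mu> (sgn_tail (-1)) t) / 2"
    unfolding H lattice_H_def by (simp add: algebra_simps)
  moreover have "0 \<le> H t" unfolding H by (rule tendsto_lowerbound[OF lim1]) (auto simp: \<rho>_nonneg)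
  ultimately show ?case using sums exp_asymp_\<rho>[OF lim1] exp_asymp_\<rho>[OF lim2]
    unfolding g_abs H[symmetric] by blast
qed

end

theorem theorem3p6:
  fixes M :: "'a measure" and N :: "'a \<Rightarrow> enat" and C :: "nat \<Rightarrow> 'a \<Rightarrow> real" and R :: "'a \<Rightarrow> real"
    and \<alpha> \<gamma> l :: real
  defines "\<mu> \<equiv> weight_drift M N C \<alpha>"
  defines "Hplus \<equiv> lattice_H M N C R \<alpha> l \<mu> right_tail"
    and "Hminus \<equiv> lattice_H M N C R \<alpha> l \<mu> left_tail"
    and "H \<equiv> lattice_H M N C R \<alpha> l (2 * \<mu>) abs_tail"
    and "summable_at \<equiv> \<lambda>T t. lattice_term M N C R \<alpha> l T t summable_on UNIV"
    and "P \<equiv> \<lambda>A. measure M {\<omega> \<in> space M. R \<omega> \<in> A}"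
  assumes "prob_space M"
    and "weight_vector N C \<in> M \<rightarrow>\<^sub>M vector_algebra"
    and "R \<in> borel_measurable M"
    and "indep_of_weights M N C R"
    and "\<alpha> > 0"
    and "lattice_span M N C l"
    and "\<mu> > 0"
    and "weight_moment M N C \<alpha> = 1"
    and "0 \<le> \<gamma>" and "\<gamma> < \<alpha>" and "weight_moment M N C \<gamma> < \<infinity>"
  shows
    "(weights_nonneg M N C \<longrightarrow>
        (lower_moments_finite M \<alpha> (\<lambda>\<omega>. max (R \<omega>) 0) \<and> gap_integrable M N C R \<alpha> right_tail \<longrightarrow>
           (AE t in lborel. summable_at right_tail t \<and> 0 \<le> Hplus t \<and>
              exp_asymp \<alpha> l t (\<lambda>n. P {x. x > exp (t + l * real n)}) (Hplus t))) \<and>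
        (lower_moments_finite M \<alpha> (\<lambda>\<omega>. max (- R \<omega>) 0) \<and> gap_integrable M N C R \<alpha> left_tail \<longrightarrow>
           (AE t in lborel. summable_at left_tail t \<and> 0 \<le> Hminus t \<and>
              exp_asymp \<alpha> l t (\<lambda>n. P {x. x < - exp (t + l * real n)}) (Hminus t)))) \<and>
     ((\<exists>j\<ge>1. measure M {\<omega> \<in> space M. j \<in> present (N \<omega>) \<and> C j \<omega> < 0} > 0) \<and>
      \<not> sign_locked M N C l \<and>
      lower_moments_finite M \<alpha> (\<lambda>\<omega>. \<bar>R \<omega>\<bar>) \<and>
      gap_integrable M N C R \<alpha> right_tail \<and> gap_integrable M N C R \<alpha> left_tail \<longrightarrow>
        (AE t in lborel.
           summable_at right_tail t \<and> summable_at left_tail t \<and> summable_at abs_tail t \<and>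
           0 \<le> H t \<and> H t = (Hplus t + Hminus t) / 2 \<and>
           exp_asymp \<alpha> l t (\<lambda>n. P {x. x > exp (t + l * real n)}) (H t) \<and>
           exp_asymp \<alpha> l t (\<lambda>n. P {x. x < - exp (t + l * real n)}) (H t)))"
proof -
  interpret prob_space M by fact
  interpret weighted_branching M N C R \<alpha> \<gamma> l
    by unfold_locales (use assms in auto)
  have drift: "0 < weight_drift M N C \<alpha>" using assms by simp
  have tails: "right_tail u = {x. x > u}" "left_tail u = {x. x < - u}" for u
    by (simp_all add: right_tail_def left_tail_def)
  have plus: "lower_moments_finite M \<alpha> (\<lambda>\<omega>. max (R \<omega>) 0) = lower_moments_finite M \<alpha> (\<lambda>\<omega>. max (1 * R \<omega>) 0)"
    and minus: "lower_moments_finite M \<alpha> (\<lambda>\<omega>. max (- R \<omega>) 0) = lower_moments_finite M \<alpha> (\<lambda>\<omega>. max (-1 * R \<omega>) 0)"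
    by simp_all
  show ?thesis
    unfolding assms(1-6) plus minus tails[symmetric] right_tail_eq left_tail_eq
    using nonneg_weights_limit[OF drift, of 1] nonneg_weights_limit[OF drift, of "-1"]
      signed_weights_limit[OF drift]
    by blast
qed

end
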